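(* Let $K$ be an infinite field. The space $\mathfrak{gl}_\infty$ of $\mathbb{N}\times\mathbb{N}$ matrices over $K$ is $\mathrm{SL}_\infty$-Noetherian, i.e. every descending sequence of $\mathrm{SL}_\infty$-stable closed subsets of $\mathfrak{gl}_\infty$ stabilizes. Any $\mathrm{SL}_\infty$-stable closed subset of $\mathfrak{gl}_\infty$ is a finite union of irreducible $\mathrm{SL}_\infty$-stable closed subsets, and the irreducible $\mathrm{SL}_\infty$-stable closed subsets of $\mathfrak{gl}_\infty$ are $\mathfrak{gl}_\infty$ itself together with the subsets $$\{P\in\mathfrak{gl}_\infty\mid\mathrm{rk}(P,I_\infty)\leq k\},\qquad\{P\in\mathfrak{gl}_\infty\mid\mathrm{rk}(P-\lambda I_\infty)\leq k\}$$ for $\lambda\in K$ and $k\in\mathbb{Z}_{\geq0}$.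
   Context: $\mathbb{N}$ denotes the positive integers. $\mathfrak{gl}_n$ is the space of $n\times n$ matrices over $K$; $\mathfrak{gl}_\infty$ is the inverse limit of $\mathfrak{gl}_1\leftarrow\mathfrak{gl}_2\leftarrow\cdots$, where $\mathfrak{gl}_{n+1}\to\mathfrak{gl}_n$ takes the top-left $n\times n$ submatrix; $\mathrm{pr}_n\colon\mathfrak{gl}_\infty\to\mathfrak{gl}_n$ is the projection; $I_\infty$ is the infinite identity matrix. $\mathrm{SL}_\infty$ is the direct limit of the groups $\mathrm{SL}_n(K)$ along $A\mapsto\mathrm{Diag}(A,1)$, acting on $\mathfrak{gl}_\infty$ by conjugation. A subset of $\mathfrak{gl}_\infty$ is closed if it is the inverse limit of a sequence of Zariski-closed subsets $X_n\subseteq\mathfrak{gl}_n$. A closed subset $X$ is called irreducible if whenever $X=Y\cup Z$ with $Y,Z\subseteq X$ closed (not necessarily $\mathrm{SL}_\infty$-stable), then $X=Y$ or $X=Z$ (and, in the list of irreducible closed subsets, $X$ is nonempty). For $P\in\mathfrak{gl}_\infty$, $\mathrm{rk}(P)=\sup\{\mathrm{rk}(\mathrm{pr}_n(P))\mid n\in\mathbb{N}\}\in\mathbb{Z}_{\geq0}\cup\{\infty\}$. For $Q_1,\dots,Q_k\in\mathfrak{gl}_n$ with $n\in\mathbb{N}\cup\{\infty\}$, the rank of the tuple is $\mathrm{rk}(Q_1,\dots,Q_k)=\inf\{\mathrm{rk}(\mu_1Q_1+\dots+\mu_kQ_k)\mid(\mu_1:\dots:\mu_k)\in\mathbb{P}^{k-1}(K)\}$.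 *)

theory Defs
  imports
    "Jordan_Normal_Form.DL_Rank"
    "HOL-Library.Groups_Big_Fun"
    "HOL-Library.Extended_Nat"
begin

text \<open>
  Rows and columns are numbered from 0, so the top-left \<open>n \<times> n\<close> block of an infinite matrix
  consists of the entries \<open>P i j\<close> with \<open>i, j < n\<close>. Every function \<open>nat \<Rightarrow> nat \<Rightarrow> 'a\<close> is an
  element of the inverse limit of the spaces \<open>carrier_mat n n\<close>, and conversely.
\<close>

type_synonym 'a inf_mat = "nat \<Rightarrow> nat \<Rightarrow> 'a"

definition id_inf :: "'a::field inf_mat" where
  "id_inf = (\<lambda>i j. if i = j then 1 else 0)"

definition pr :: "nat \<Rightarrow> 'a inf_mat \<Rightarrow> 'a mat" where
  "pr n P = mat n n (\<lambda>(i, j). P i j)"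

definition top_left :: "nat \<Rightarrow> 'a mat \<Rightarrow> 'a mat" where
  "top_left n A = mat n n (\<lambda>(i, j). A $$ (i, j))"


text \<open>A polynomial in the \<open>n\<^sup>2\<close> entries: finitely many exponent families \<open>m \<in> M\<close> with coefficients \<open>c m\<close>.\<close>

definition polynomial_function :: "nat \<Rightarrow> ('a::field mat \<Rightarrow> 'a) \<Rightarrow> bool" where
  "polynomial_function n f \<longleftrightarrow>
    (\<exists>(M :: (nat \<times> nat \<Rightarrow> nat) set) c. finite M \<and>
      f = (\<lambda>A. \<Sum>m\<in>M. c m * (\<Prod>ij\<in>{..<n} \<times> {..<n}. (A $$ ij) ^ m ij)))"

definition zariski_closed :: "nat \<Rightarrow> 'a::field mat set \<Rightarrow> bool" where
  "zariski_closed n X \<longleftrightarrow>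
    (\<exists>S. (\<forall>f\<in>S. polynomial_function n f) \<and> X = {A \<in> carrier_mat n n. \<forall>f\<in>S. f A = 0})"

text \<open>The second condition says that the sets \<open>Y n\<close> form an inverse system.\<close>

definition closed_inf :: "'a::field inf_mat set \<Rightarrow> bool" where
  "closed_inf X \<longleftrightarrow>
    (\<exists>Y. (\<forall>n\<ge>1. zariski_closed n (Y n)) \<and>
         (\<forall>n\<ge>1. top_left n ` Y (Suc n) \<subseteq> Y n) \<and>
         X = {P. \<forall>n\<ge>1. pr n P \<in> Y n})"

definition irreducible_inf :: "'a::field inf_mat set \<Rightarrow> bool" where
  "irreducible_inf X \<longleftrightarrow> closed_inf X \<and> X \<noteq> {} \<and>
    (\<forall>Y Z. closed_inf Y \<and> closed_inf Z \<and> Y \<subseteq> X \<and> Z \<subseteq> X \<and> X = Y \<union> Z \<longrightarrow> X = Y \<or> X = Z)"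


text \<open>
  The transition maps \<open>A \<mapsto> Diag(A, 1)\<close> are injective, so the direct limit of the groups
  \<open>SL\<^sub>n\<close> is the union of their images under \<open>A \<mapsto> Diag(A, 1, 1, \<dots>)\<close>.
\<close>

definition diag_inf :: "'a::field mat \<Rightarrow> 'a inf_mat" where
  "diag_inf A = (\<lambda>i j. if i < dim_row A \<and> j < dim_col A then A $$ (i, j) else id_inf i j)"

text \<open>
  \<open>Sum_any\<close> is the sum over the support. In the products \<open>g P\<close> and \<open>P g\<close> with \<open>g\<close> of the form
  \<open>diag_inf A\<close> all these supports are finite, for every infinite matrix \<open>P\<close>.
\<close>

definition mult_inf :: "'a::field inf_mat \<Rightarrow> 'a inf_mat \<Rightarrow> 'a inf_mat" where
  "mult_inf P Q = (\<lambda>i j. Sum_any (\<lambda>k. P i k * Q k j))"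

definition SL_inf :: "'a::field inf_mat monoid" where
  "SL_inf = \<lparr>carrier = {diag_inf A | A n. n \<ge> 1 \<and> A \<in> carrier_mat n n \<and> det A = 1},
             monoid.mult = mult_inf, one = id_inf\<rparr>"

definition SL_stable :: "'a::field inf_mat set \<Rightarrow> bool" where
  "SL_stable X \<longleftrightarrow>
    (\<forall>g\<in>carrier SL_inf. \<forall>P\<in>X. mult_inf (mult_inf g P) (inv\<^bsub>SL_inf\<^esub> g) \<in> X)"


definition rk_inf :: "'a::field inf_mat \<Rightarrow> enat" where
  "rk_inf P = (SUP n\<in>{1..}. enat (vec_space.rank n (pr n P)))"

text \<open>
  The infimum over projective space is taken over all nonzero coefficient vectors; scaling the
  vector does not change the rank of the linear combination.
\<close>

definition rk_tuple_inf :: "'a::field inf_mat list \<Rightarrow> enat" where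
  "rk_tuple_inf Qs =
    (INF \<mu>\<in>{\<mu> :: nat \<Rightarrow> 'a. \<exists>l<length Qs. \<mu> l \<noteq> 0}.
      rk_inf (\<lambda>i j. \<Sum>l<length Qs. \<mu> l * (Qs ! l) i j))"

end

theory Submission
  imports Defs "HOL-Computational_Algebra.Polynomial"
begin

text \<open>
  For \<open>u\<^sub>1, \<dots>, u\<^sub>n\<close> of finite support with all \<open>u\<^sub>i\<close>, \<open>P u\<^sub>i\<close> linearly independent, the conjugates
  of \<open>P\<close> realise every \<open>n \<times> n\<close> matrix as top-left block. If there are no such vectors, then \<open>u\<close> and
  \<open>P u\<close> are dependent modulo a fixed finite-dimensional space for all \<open>u\<close>, so \<open>P\<close> is a scalar plus
  a matrix of rank at most \<open>2 n\<close>. A proper stable closed \<open>X\<close> therefore consists of matrices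
  \<open>c + B\<close> with \<open>B\<close> of bounded rank.

  If \<open>B\<close> has rank \<open>r\<close>, then the orbit closure of \<open>c + B\<close> contains \<open>c + C\<close> for all \<open>C\<close> of rank at most \<open>r\<close>:
  vectors far out in the kernel of \<open>B\<close> can be added freely. So \<open>X\<close> is determined by the sets
  \<open>{c. c + D\<^sub>r \<in> X}\<close> with \<open>D\<^sub>r\<close> a fixed matrix of rank \<open>r\<close>. These are Zariski closed in the line,
  hence finite or everything, which gives the decomposition and the chain condition.

  Irreducibility only needs polynomials in one variable, since any two points of the sets in the
  list are joined by a polynomial curve inside the set.
\<close>

section \<open>Linear algebra of sequences\<close>

text \<open>A closed set is visible only through its finite blocks, so membership in an orbit
  closure is proved by matching, for each \<open>n\<close>, the top-left \<open>n \<times> n\<close>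
  block of some conjugate. Entry \<open>(i, j)\<close> of a conjugate is \<open>f i\<close> paired
  with \<open>P (v j)\<close>, where the rows \<open>f i\<close> and the columns \<open>v j\<close>
  are biorthogonal. Both have finite support, whereas \<open>P (v j)\<close> is an arbitrary
  sequence. Hence the linear algebra of finite families of sequences and of finitely supported
  functionals: finitely many independent sequences are already separated by finitely many
  coordinates. Working in SL instead of GL costs one spare coordinate outside the block, where the
  determinant is corrected.

  The bound \<open>2 n\<close> is coarse; it counts the vectors \<open>u i\<close>,
  \<open>P (u i)\<close>. It suffices to bound the rank on a proper stable set. Closedness of the
  set of all \<open>c + B\<close> with \<open>B\<close> of rank at most \<open>k\<close> needs the
  sharp form: such a \<open>c\<close> exists exactly when no \<open>k + 1\<close> vectors
  \<open>u i\<close> make all \<open>u i\<close>, \<open>P (u i)\<close> independent.\<close>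

definition indep :: "nat \<Rightarrow> (nat \<Rightarrow> nat \<Rightarrow> 'k::field) \<Rightarrow> bool" where
  "indep m x \<longleftrightarrow> (\<forall>c. (\<forall>k. (\<Sum>i<m. c i * x i k) = 0) \<longrightarrow> (\<forall>i<m. c i = 0))"

definition inspan :: "nat \<Rightarrow> (nat \<Rightarrow> nat \<Rightarrow> 'k::field) \<Rightarrow> (nat \<Rightarrow> 'k) \<Rightarrow> bool" where
  "inspan m x y \<longleftrightarrow> (\<exists>c. \<forall>k. y k = (\<Sum>i<m. c i * x i k))"

lemma indepD: "indep m x \<Longrightarrow> (\<And>k. (\<Sum>i<m. c i * x i k) = 0) \<Longrightarrow> i < m \<Longrightarrow> c i = 0"
  unfolding indep_def by blast

lemma indep_cong: "(\<And>i. i < m \<Longrightarrow> x i = y i) \<Longrightarrow> indep m x = indep m y"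
proof -
  assume "\<And>i. i < m \<Longrightarrow> x i = y i"
  then have "(\<Sum>i<m. c i * x i k) = (\<Sum>i<m. c i * y i k)" for c k
    by (intro sum.cong) auto
  then show ?thesis by (simp add: indep_def)
qed

lemma inspan_cong: "(\<And>i. i < m \<Longrightarrow> x i = y i) \<Longrightarrow> inspan m x = inspan m y"
proof -
  assume "\<And>i. i < m \<Longrightarrow> x i = y i"
  then have "(\<Sum>i<m. c i * x i k) = (\<Sum>i<m. c i * y i k)" for c k
    by (intro sum.cong) auto
  then show ?thesis unfolding inspan_def by simp
qed

lemma indep_0 [simp]: "indep 0 x"
  unfolding indep_def by simp

lemma indep_subfamily: "indep n x \<Longrightarrow> m \<le> n \<Longrightarrow> indep m x"
  unfolding indep_def
proof (intro allI impI)
  fix c i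
  assume *: "\<forall>c. (\<forall>k. (\<Sum>i<n. c i * x i k) = 0) \<longrightarrow> (\<forall>i<n. c i = 0)" "m \<le> n"
    "\<forall>k. (\<Sum>i<m. c i * x i k) = 0" "i < m"
  have "(\<Sum>i<n. (if i < m then c i else 0) * x i k) = (\<Sum>i<m. c i * x i k)" for k
    by (rule sum.mono_neutral_cong_right) (use *(2) in auto)
  then have "\<forall>k. (\<Sum>i<n. (if i < m then c i else 0) * x i k) = 0"
    using *(3) by simp
  then have "\<forall>i<n. (if i < m then c i else 0) = 0"
    by (rule *(1)[THEN spec, of "\<lambda>i. if i < m then c i else 0", THEN mp])
  then show "c i = 0" using *(2,4) by (meson dual_order.strict_trans1)
qed

lemma inspan_lincomb:
  assumes "inspan m x y" "inspan m x z"
  shows "inspan m x (\<lambda>k. y k + c * z k)"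
proof -
  obtain p q where "\<And>k. y k = (\<Sum>i<m. p i * x i k)" "\<And>k. z k = (\<Sum>i<m. q i * x i k)"
    using assms unfolding inspan_def by blast
  then show ?thesis unfolding inspan_def
    by (intro exI[of _ "\<lambda>i. p i + c * q i"])
       (simp add: distrib_right sum.distrib sum_distrib_left mult.assoc)
qed

lemma inspan_zero: "inspan m x (\<lambda>k. 0)"
  unfolding inspan_def by (intro exI[of _ "\<lambda>i. 0"]) simp

lemma inspan_sum:
  "finite I \<Longrightarrow> (\<And>l. l \<in> I \<Longrightarrow> inspan m x (y l)) \<Longrightarrow> inspan m x (\<lambda>k. \<Sum>l\<in>I. c l * y l k)"
proof (induction I rule: finite_induct)
  case (insert l I)
  then show ?case using inspan_lincomb[of m x "\<lambda>k. \<Sum>l\<in>I. c l * y l k" "y l" "c l"]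
    by (simp add: add.commute)
qed (simp add: inspan_zero)

lemma inspan_base: assumes "i < m" shows "inspan m x (x i)"
  unfolding inspan_def
  by (intro exI[of _ "\<lambda>j. if j = i then 1 else 0"]) (use assms in \<open>simp add: if_distrib[of "\<lambda>c. c * _"] cong: if_cong\<close>)

lemma inspan_trans:
  assumes "inspan m x y" "\<And>i. i < m \<Longrightarrow> inspan n z (x i)"
  shows "inspan n z y"
proof -
  obtain c where "\<And>k. y k = (\<Sum>i<m. c i * x i k)"
    using assms(1) unfolding inspan_def by blast
  then have "y = (\<lambda>k. \<Sum>i<m. c i * x i k)" by auto
  then show ?thesis using assms(2) inspan_sum[of "{..<m}" n z x c] by auto
qed

lemma indep_Suc:
  assumes "indep m x" "\<not> inspan m x (x m)"
  shows "indep (Suc m) x"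
  unfolding indep_def
proof (intro allI impI)
  fix c i assume c: "\<forall>k. (\<Sum>i<Suc m. c i * x i k) = 0" and i: "i < Suc m"
  have "c m = 0"
  proof (rule ccontr)
    assume "c m \<noteq> 0"
    have "x m k = (\<Sum>i<m. (- c i / c m) * x i k)" for k
    proof -
      have "c m * x m k = - (\<Sum>i<m. c i * x i k)"
        using c by (simp add: eq_neg_iff_add_eq_0 add.commute)
      then have "x m k = - (\<Sum>i<m. c i * x i k) / c m"
        using \<open>c m \<noteq> 0\<close> by (simp add: field_simps)
      then show ?thesis by (simp add: sum_divide_distrib sum_negf)
    qed
    then have "inspan m x (x m)" unfolding inspan_def by (intro exI[of _ "\<lambda>i. - c i / c m"]) blast
    with assms(2) show False by simp
  qed
  moreover have "c j = 0" if "j < m" for j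
    by (rule indepD[OF assms(1) _ that]) (use c \<open>c m = 0\<close> in simp)
  ultimately show "c i = 0" using i less_Suc_eq by auto
qed

lemma indep_not_inspan:
  assumes "indep (Suc m) x" shows "\<not> inspan m x (x m)"
proof
  assume "inspan m x (x m)"
  then obtain c where c: "\<And>k. x m k = (\<Sum>i<m. c i * x i k)" unfolding inspan_def by blast
  have "(if m < m then - c m else 1::'a) = 0"
    by (rule indepD[OF assms, of "\<lambda>i. if i < m then - c i else 1" m])
       (simp_all add: c sum_negf)
  then show False by simp
qed

text \<open>Gaussian elimination, by induction on the number of equations: a row \<open>p\<close>
  with nonzero entry in the last column determines the last unknown, and \<open>B\<close> holds the
  other rows after that column has been cleared.\<close>

lemma homogeneous_system:
  fixes A :: "nat \<Rightarrow> nat \<Rightarrow> 'k::field"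
  assumes "n < m"
  shows "\<exists>c. (\<exists>i<m. c i \<noteq> 0) \<and> (\<forall>l<n. (\<Sum>i<m. c i * A l i) = 0)"
  using assms
proof (induction n arbitrary: m A)
  case 0
  then show ?case by (intro exI[of _ "\<lambda>_. 1"]) auto
next
  case (Suc n)
  then obtain m' where m': "m = Suc m'" "n < m'" by (cases m) auto
  show ?case
  proof (cases "\<exists>l<Suc n. A l m' \<noteq> 0")
    case False
    then show ?thesis using m' by (intro exI[of _ "\<lambda>i. if i = m' then 1 else 0"]) auto
  next
    case True
    then obtain p where p: "p < Suc n" "A p m' \<noteq> 0" by blast
    define r where "r l = (if l < p then l else Suc l)" for l
    define B where "B l i = A (r l) i - A (r l) m' / A p m' * A p i" for l i
    obtain c where c: "\<exists>i<m'. c i \<noteq> 0" "\<forall>l<n. (\<Sum>i<m'. c i * B l i) = 0"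
      using Suc.IH[OF m'(2), of B] by blast
    define s where "s = (\<Sum>i<m'. c i * A p i) / A p m'"
    define d where "d i = (if i < m' then c i else - s)" for i
    have d: "(\<Sum>i<m. d i * A l i) = (\<Sum>i<m'. c i * A l i) - s * A l m'" for l
      using m' by (simp add: d_def)
    have "(\<Sum>i<m. d i * A l i) = 0" if l: "l < Suc n" for l
    proof (cases "l = p")
      case True
      then show ?thesis using p d[of p] by (simp add: s_def)
    next
      case False
      then obtain l' where l': "l' < n" "r l' = l"
      proof (cases "l < p")
        case True
        then show ?thesis using that[of l] p by (auto simp: r_def)
      next
        case F: False
        then have "p < l" using False by auto
        then show ?thesis using that[of "l - 1"] l by (auto simp: r_def)
      qed
      have "0 = (\<Sum>i<m'. c i * B l' i)" using c l' by simp
      also have "\<dots> = (\<Sum>i<m'. c i * A l i) - A l m' / A p m' * (\<Sum>i<m'. c i * A p i)"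
        unfolding B_def l' by (simp add: right_diff_distrib sum_subtractf sum_distrib_left mult.left_commute)
      finally show ?thesis using d[of l] by (simp add: s_def mult.commute)
    qed
    moreover have "\<exists>i<m. d i \<noteq> 0" using c(1) m' by (auto simp: d_def intro: less_SucI)
    ultimately show ?thesis by blast
  qed
qed

text \<open>Steinitz bound: for \<open>n < m\<close> the rows of the coefficient matrix of the
  \<open>y i\<close> over the \<open>x l\<close> satisfy a nontrivial relation, which is then a
  relation among the \<open>y i\<close>.\<close>

lemma indep_card_le:
  assumes "indep m y" "\<And>i. i < m \<Longrightarrow> inspan n x (y i)"
  shows "m \<le> n"
proof (rule ccontr)
  assume "\<not> m \<le> n"
  obtain C where C: "\<And>i k. i < m \<Longrightarrow> y i k = (\<Sum>l<n. C i l * x l k)"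
    using assms(2) unfolding inspan_def by metis
  obtain c where c: "\<exists>i<m. c i \<noteq> 0" "\<forall>l<n. (\<Sum>i<m. c i * C i l) = 0"
    using homogeneous_system[of n m "\<lambda>l i. C i l"] \<open>\<not> m \<le> n\<close> by auto
  have "(\<Sum>i<m. c i * y i k) = 0" for k
  proof -
    have "(\<Sum>i<m. c i * y i k) = (\<Sum>i<m. \<Sum>l<n. c i * C i l * x l k)"
      by (simp add: C sum_distrib_left mult.assoc)
    also have "\<dots> = (\<Sum>l<n. (\<Sum>i<m. c i * C i l) * x l k)"
      by (subst sum.swap) (simp add: sum_distrib_right)
    finally show ?thesis using c by simp
  qed
  then show False using indepD[OF assms(1)] c(1) by blast
qed

lemma indep_unit: "indep m (id_inf :: 'k::field inf_mat)"
  unfolding indep_def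
proof (intro allI impI)
  fix c :: "nat \<Rightarrow> 'k" and i assume c: "\<forall>k. (\<Sum>i<m. c i * id_inf i k) = 0" "i < m"
  have "(\<Sum>j<m. c j * id_inf j i) = c i"
    using c(2) by (simp add: id_inf_def if_distrib cong: if_cong)
  with c show "c i = 0" by simp
qed

text \<open>Supplies vectors in general position: arbitrarily many unit vectors are independent, so
  a finite family cannot span all of them.\<close>

lemma unit_not_inspan:
  fixes x :: "nat \<Rightarrow> nat \<Rightarrow> 'k::field"
  obtains i where "\<not> inspan m x (id_inf i)"
  using indep_card_le[OF indep_unit[of "Suc m"], of m x] by auto

section \<open>Pairings of sequences with functionals of finite support\<close>

definition finsup :: "(nat \<Rightarrow> 'k::field) \<Rightarrow> bool" where
  "finsup f \<longleftrightarrow> (\<exists>N. \<forall>k\<ge>N. f k = 0)"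

text \<open>The sum runs over the support of \<open>f\<close>, which is meant to be finite, while
  \<open>x\<close> may be any sequence. Over an infinite support the sum has the default value 0, so
  additivity in \<open>f\<close> is stated under \<open>finsup\<close>, whereas linearity in
  \<open>x\<close> holds outright.\<close>

definition dot :: "(nat \<Rightarrow> 'k::field) \<Rightarrow> (nat \<Rightarrow> 'k) \<Rightarrow> 'k" where
  "dot f x = (\<Sum>k | f k \<noteq> 0. f k * x k)"

definition app :: "'k::field inf_mat \<Rightarrow> (nat \<Rightarrow> 'k) \<Rightarrow> nat \<Rightarrow> 'k" where
  "app P v = (\<lambda>i. dot v (P i))"

lemma dot_eq: assumes "\<And>k. k \<ge> N \<Longrightarrow> f k = 0" shows "dot f x = (\<Sum>k<N. f k * x k)"
  unfolding dot_def
  by (rule sum.mono_neutral_left) (use assms in \<open>auto simp: not_less[symmetric]\<close>)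

lemma finsup_unit [simp]: "finsup (id_inf i :: nat \<Rightarrow> 'k::field)"
  unfolding finsup_def id_inf_def by (intro exI[of _ "Suc i"]) auto

lemma finsup_zero [simp]: "finsup (\<lambda>k. 0 :: 'k::field)"
  unfolding finsup_def by auto

lemma finsup_add [simp]: "finsup f \<Longrightarrow> finsup g \<Longrightarrow> finsup (\<lambda>k. f k + g k)"
  unfolding finsup_def by (metis add.right_neutral le_trans nle_le)

lemma finsup_mult [simp]: "finsup f \<Longrightarrow> finsup (\<lambda>k. c * f k)"
  unfolding finsup_def by auto

lemma finsup_diff [simp]: "finsup f \<Longrightarrow> finsup g \<Longrightarrow> finsup (\<lambda>k. f k - g k)"
  using finsup_add[of f "\<lambda>k. (-1) * g k"] finsup_mult[of g "-1"] by simp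

lemma finsup_sum: "finite I \<Longrightarrow> (\<And>i. i \<in> I \<Longrightarrow> finsup (f i)) \<Longrightarrow> finsup (\<lambda>k. \<Sum>i\<in>I. f i k)"
  by (induction I rule: finite_induct) auto

lemma finsup_common:
  assumes "\<And>i. i < (m::nat) \<Longrightarrow> finsup (f i)"
  shows "\<exists>N. \<forall>i<m. \<forall>k\<ge>N. f i k = 0"
proof -
  obtain N where N: "\<And>i k. i < m \<Longrightarrow> k \<ge> N i \<Longrightarrow> f i k = 0"
    using assms unfolding finsup_def by metis
  have "f i k = 0" if "i < m" "k \<ge> Max (insert 0 (N ` {..<m}))" for i k
  proof (rule N)
    have "N i \<le> Max (insert 0 (N ` {..<m}))" using that by simp
    then show "N i \<le> k" using that by linarith
  qed (use that in auto)
  then show ?thesis by blast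
qed

lemma dot_unit [simp]: "dot (id_inf i) x = x i"
  by (subst dot_eq[of "Suc i"]) (auto simp: id_inf_def if_distrib[of "\<lambda>c. c * _"] cong: if_cong)

lemma dot_add_left:
  assumes "finsup f" "finsup g" shows "dot (\<lambda>k. f k + c * g k) x = dot f x + c * dot g x"
proof -
  obtain M1 M2 where "\<forall>k\<ge>M1. f k = 0" "\<forall>k\<ge>M2. g k = 0"
    using assms unfolding finsup_def by blast
  then obtain N where N: "\<And>k. k \<ge> N \<Longrightarrow> f k = 0" "\<And>k. k \<ge> N \<Longrightarrow> g k = 0"
    using that[of "max M1 M2"] by simp
  have "dot f x = (\<Sum>k<N. f k * x k)" "dot g x = (\<Sum>k<N. g k * x k)"
    "dot (\<lambda>k. f k + c * g k) x = (\<Sum>k<N. (f k + c * g k) * x k)"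
    by (rule dot_eq, simp add: N)+
  then show ?thesis
    by (simp add: distrib_right sum.distrib sum_distrib_left mult.assoc)
qed

lemma dot_zero_left [simp]: "dot (\<lambda>k. 0) x = 0"
  by (simp add: dot_def)

lemma dot_mult_left: "finsup f \<Longrightarrow> dot (\<lambda>k. c * f k) x = c * dot f x"
  using dot_add_left[of "\<lambda>k. 0" f c x] by simp

lemma dot_diff_left: "finsup f \<Longrightarrow> finsup g \<Longrightarrow> dot (\<lambda>k. f k - g k) x = dot f x - dot g x"
  using dot_add_left[of f g "-1" x] by simp

lemma dot_sum_left:
  "finite I \<Longrightarrow> (\<And>i. i \<in> I \<Longrightarrow> finsup (f i)) \<Longrightarrow>
     dot (\<lambda>k. \<Sum>i\<in>I. c i * f i k) x = (\<Sum>i\<in>I. c i * dot (f i) x)"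
proof (induction I rule: finite_induct)
  case (insert i I)
  have "dot (\<lambda>k. (\<Sum>i\<in>I. c i * f i k) + c i * f i k) x = dot (\<lambda>k. \<Sum>i\<in>I. c i * f i k) x + c i * dot (f i) x"
    by (rule dot_add_left) (use insert in \<open>auto intro!: finsup_sum\<close>)
  then show ?case using insert by (simp add: add.commute)
qed simp

lemma dot_add_right: "dot f (\<lambda>k. x k + c * y k) = dot f x + c * dot f y"
  by (simp add: dot_def distrib_left sum.distrib sum_distrib_left mult.left_commute)

lemma dot_diff_right: "dot f (\<lambda>k. x k - y k) = dot f x - dot f y"
  by (simp add: dot_def right_diff_distrib sum_subtractf)

lemma dot_mult_right: "dot f (\<lambda>k. c * y k) = c * dot f y"
  by (simp add: dot_def sum_distrib_left mult.left_commute)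

lemma dot_sum_right: "dot f (\<lambda>k. \<Sum>i\<in>I. c i * x i k) = (\<Sum>i\<in>I. c i * dot f (x i))"
  unfolding dot_def
  by (simp add: sum_distrib_left mult.left_commute) (rule sum.swap)

text \<open>Induction in the manner of Gram-Schmidt. Removing from \<open>x m\<close> its components
  along the earlier \<open>x i\<close> leaves \<open>y \<noteq> 0\<close>. A coordinate
  \<open>k\<close> with \<open>y k \<noteq> 0\<close>, corrected by the earlier \<open>f i\<close>
  and scaled by \<open>1 / y k\<close>, is a functional \<open>h\<close> that kills those
  \<open>x i\<close> and is 1 on \<open>x m\<close>. Only finitely many coordinates enter, hence
  finite support.\<close>

lemma dual_family:
  fixes x :: "nat \<Rightarrow> nat \<Rightarrow> 'k::field"
  assumes "indep m x"
  shows "\<exists>f. (\<forall>i<m. finsup (f i)) \<and> (\<forall>i<m. \<forall>j<m. dot (f i) (x j) = id_inf i j)"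
  using assms
proof (induction m)
  case (Suc m)
  obtain f where f: "\<And>i. i < m \<Longrightarrow> finsup (f i)" "\<And>i j. i < m \<Longrightarrow> j < m \<Longrightarrow> dot (f i) (x j) = id_inf i j"
    using Suc indep_subfamily[OF Suc.prems, of m] by auto
  define y where "y k = x m k - (\<Sum>i<m. dot (f i) (x m) * x i k)" for k
  have "\<exists>k. y k \<noteq> 0"
  proof (rule ccontr)
    assume "\<not> ?thesis"
    then have "inspan m x (x m)" unfolding inspan_def y_def
      by (intro exI[of _ "\<lambda>i. dot (f i) (x m)"]) auto
    with indep_not_inspan[OF Suc.prems] show False by simp
  qed
  then obtain k where k: "y k \<noteq> 0" by blast
  define h where "h l = (1 / y k) * (id_inf k l - (\<Sum>i<m. x i k * f i l))" for l
  have fh: "finsup h" unfolding h_def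
    by (intro finsup_mult finsup_diff finsup_sum finsup_unit) (use f in auto)
  have dh: "dot h z = (1 / y k) * (z k - (\<Sum>i<m. x i k * dot (f i) z))" for z
    unfolding h_def
    apply (subst dot_mult_left)
     apply (intro finsup_diff finsup_sum finsup_unit finsup_mult)
      apply (use f in auto)[2]
    apply (subst dot_diff_left)
      apply (intro finsup_sum finsup_unit finsup_mult)
     apply (intro finsup_sum finsup_unit finsup_mult)
      apply (use f in auto)[2]
    apply (subst dot_sum_left)
      apply (use f in auto)
    done
  have h1: "dot h (x j) = 0" if "j < m" for j
  proof -
    have "(\<Sum>i<m. x i k * dot (f i) (x j)) = (\<Sum>i<m. if i = j then x j k else 0)"
      by (rule sum.cong) (use that f(2) in \<open>auto simp: id_inf_def\<close>)
    then show ?thesis using that by (simp add: dh)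
  qed
  have h2: "dot h (x m) = 1"
    using k by (simp add: dh y_def mult.commute)
  \<comment> \<open>Subtracting a multiple of \<open>h\<close> makes the old functionals vanish on
    \<open>x m\<close> and keeps their values on the earlier vectors.\<close>
  define g where "g i = (if i < m then (\<lambda>l. f i l + (- dot (f i) (x m)) * h l) else h)" for i
  have "finsup (g i)" if "i < Suc m" for i
    unfolding g_def using f fh by (auto intro!: finsup_add finsup_mult simp del: mult_minus_left)
  moreover have "dot (g i) (x j) = id_inf i j" if "i < Suc m" "j < Suc m" for i j
  proof (cases "i < m")
    case True
    then have "dot (g i) (x j) = dot (f i) (x j) + (- dot (f i) (x m)) * dot h (x j)"
      using dot_add_left[OF f(1)[OF True] fh, of "- dot (f i) (x m)"] by (simp add: g_def)
    then show ?thesis using True that f(2) h1 h2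
      by (cases "j = m") (auto simp: id_inf_def)
  next
    case False
    then have "i = m" using that by simp
    then show ?thesis using that h1 h2 by (cases "j = m") (auto simp: g_def id_inf_def)
  qed
  ultimately show ?case by blast
qed simp

text \<open>Turns independence into the nonvanishing of some determinant, so that dependence of
  vectors varying polynomially with a matrix becomes a closed condition. Forwards, a dual family
  gives the identity matrix; backwards, a linear relation would lie in the kernel.\<close>

lemma indep_iff_det:
  "indep m x \<longleftrightarrow> (\<exists>f. (\<forall>i<m. finsup (f i)) \<and> det (mat m m (\<lambda>(i, j). dot (f i) (x j))) \<noteq> 0)"
proof
  assume "indep m x"
  then obtain f where f: "\<forall>i<m. finsup (f i)" "\<forall>i<m. \<forall>j<m. dot (f i) (x j) = id_inf i j"
    using dual_family by blast
  have "mat m m (\<lambda>(i, j). dot (f i) (x j)) = 1\<^sub>m m"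
    by (rule eq_matI) (use f in \<open>auto simp: id_inf_def\<close>)
  then show "\<exists>f. (\<forall>i<m. finsup (f i)) \<and> det (mat m m (\<lambda>(i, j). dot (f i) (x j))) \<noteq> 0"
    using f by (intro exI[of _ f]) auto
next
  assume "\<exists>f. (\<forall>i<m. finsup (f i)) \<and> det (mat m m (\<lambda>(i, j). dot (f i) (x j))) \<noteq> 0"
  then obtain f where f: "det (mat m m (\<lambda>(i, j). dot (f i) (x j))) \<noteq> 0" by blast
  define M where "M = mat m m (\<lambda>(i, j). dot (f i) (x j))"
  have M: "M \<in> carrier_mat m m" by (simp add: M_def)
  show "indep m x" unfolding indep_def
  proof (intro allI impI, rule ccontr)
    fix c i assume c: "\<forall>k. (\<Sum>i<m. c i * x i k) = 0" "i < m" "c i \<noteq> 0"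
    define v where "v = vec m c"
    have "v \<in> carrier_vec m" "v \<noteq> 0\<^sub>v m"
      using c(2,3) by (auto simp: v_def vec_eq_iff)
    moreover have "M *\<^sub>v v = 0\<^sub>v m"
    proof (rule eq_vecI)
      fix i assume i: "i < dim_vec (0\<^sub>v m :: 'a vec)"
      then have "(M *\<^sub>v v) $ i = (\<Sum>j<m. c j * dot (f i) (x j))"
        by (simp add: M_def v_def scalar_prod_def atLeast0LessThan mult.commute)
      also have "\<dots> = dot (f i) (\<lambda>k. \<Sum>j<m. c j * x j k)" by (rule dot_sum_right[symmetric])
      also have "\<dots> = 0" using c(1) by (simp add: dot_def)
      finally show "(M *\<^sub>v v) $ i = 0\<^sub>v m $ i" using i by simp
    qed (simp add: M_def)
    ultimately have "det M = 0" using det_0_iff_vec_prod_zero_field[OF M] by blast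
    then show False using f unfolding M_def by simp
  qed
qed

lemma inspan_scale: "inspan m x y \<Longrightarrow> inspan m x (\<lambda>k. c * y k)"
  using inspan_lincomb[OF inspan_zero, of m x y c] by simp

lemma inspan_diff: "inspan m x y \<Longrightarrow> inspan m x z \<Longrightarrow> inspan m x (\<lambda>k. y k - z k)"
  using inspan_lincomb[of m x y z "-1"] by simp

lemma inspan_scale_cancel:
  assumes "inspan m x (\<lambda>k. c * y k)" "c \<noteq> 0" shows "inspan m x y"
  using inspan_scale[OF assms(1), of "1 / c"] assms(2) by simp

lemma inspan_mono: "inspan m x y \<Longrightarrow> m \<le> n \<Longrightarrow> inspan n x y"
  by (rule inspan_trans[of m x y n x]) (auto intro: inspan_base)

lemma dot_unit_right: assumes "finsup v" shows "dot v (id_inf i) = v i"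
proof -
  obtain N where "\<And>k. k \<ge> N \<Longrightarrow> v k = 0" using assms unfolding finsup_def by blast
  then have "dot v (id_inf i) = (\<Sum>k<max N (Suc i). v k * id_inf i k)"
    by (intro dot_eq) auto
  also have "\<dots> = v i"
    by (simp add: id_inf_def if_distrib[of "\<lambda>c. _ * c"] cong: if_cong)
  finally show ?thesis .
qed

lemma dot_affine_left:
  assumes "finsup h" "finite I" "\<And>l. l \<in> I \<Longrightarrow> finsup (g l)"
  shows "dot (\<lambda>k. h k + (\<Sum>l\<in>I. c l * g l k)) x = dot h x + (\<Sum>l\<in>I. c l * dot (g l) x)"
    and "finsup (\<lambda>k. h k + (\<Sum>l\<in>I. c l * g l k))"
proof -
  have f: "finsup (\<lambda>k. \<Sum>l\<in>I. c l * g l k)"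
    by (intro finsup_sum finsup_mult assms)
  then show "finsup (\<lambda>k. h k + (\<Sum>l\<in>I. c l * g l k))"
    by (intro finsup_add assms)
  show "dot (\<lambda>k. h k + (\<Sum>l\<in>I. c l * g l k)) x = dot h x + (\<Sum>l\<in>I. c l * dot (g l) x)"
    using dot_add_left[OF assms(1) f, of 1] dot_sum_left[OF assms(2,3)] by simp
qed

lemma app_unit: "app P (id_inf j) = (\<lambda>i. P i j)"
  by (simp add: app_def)

lemma app_add: "finsup u \<Longrightarrow> finsup v \<Longrightarrow> app P (\<lambda>k. u k + v k) i = app P u i + app P v i"
  using dot_add_left[of u v 1] by (simp add: app_def)

section \<open>Matrices of finite rank up to scalars\<close>

definition shift :: "'k::field inf_mat \<Rightarrow> 'k \<Rightarrow> 'k inf_mat" where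
  "shift P c = (\<lambda>i j. P i j - c * id_inf i j)"

lemma app_shift: "finsup v \<Longrightarrow> app (shift P c) v i = app P v i - c * v i"
  by (simp add: app_def shift_def dot_diff_right dot_mult_right dot_unit_right)

text \<open>Rank as the number of outer products in a decomposition, which makes sense for infinite
  matrices without truncation; \<open>rk_inf_le_iff\<close> identifies it with the supremum over
  blocks.\<close>

definition rank_le :: "nat \<Rightarrow> 'k::field inf_mat \<Rightarrow> bool" where
  "rank_le k B \<longleftrightarrow> (\<exists>a b. \<forall>i j. B i j = (\<Sum>l<k. a l i * b l j))"

lemma rank_le_mono: assumes "rank_le k B" "k \<le> n" shows "rank_le n B"
proof -
  obtain a b where ab: "\<And>i j. B i j = (\<Sum>l<k. a l i * b l j)"
    using assms unfolding rank_le_def by blast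
  have "B i j = (\<Sum>l<n. (if l < k then a l i else 0) * b l j)" for i j
    unfolding ab by (rule sum.mono_neutral_cong_left) (use assms in auto)
  then show ?thesis unfolding rank_le_def
    by (intro exI[of _ "\<lambda>l i. if l < k then a l i else 0"] exI[of _ b]) blast
qed

lemma rank_le_columns:
  assumes "\<And>j. inspan k x (\<lambda>i. B i j)" shows "rank_le k B"
proof -
  obtain c where "\<And>i j. B i j = (\<Sum>l<k. c j l * x l i)"
    using assms unfolding inspan_def by metis
  then show ?thesis unfolding rank_le_def
    by (intro exI[of _ x] exI[of _ "\<lambda>l j. c j l"]) (simp add: mult.commute)
qed

lemma app_factorization:
  assumes "\<And>i j. B i j = (\<Sum>l<k. a l i * b l j)"
  shows "app B v i = (\<Sum>l<k. dot v (b l) * a l i)"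
proof -
  have "B i = (\<lambda>j. \<Sum>l<k. a l i * b l j)" by (rule ext) (rule assms)
  then show ?thesis by (simp add: app_def dot_sum_right mult.commute)
qed

lemma rank_le_indep_bound:
  assumes "rank_le k B" "indep m (\<lambda>i. app B (v i))" shows "m \<le> k"
proof -
  obtain a b where ab: "\<And>i j. B i j = (\<Sum>l<k. a l i * b l j)"
    using assms unfolding rank_le_def by blast
  show ?thesis
  proof (rule indep_card_le[OF assms(2), of k a])
    fix i show "inspan k a (app B (v i))" unfolding inspan_def
      by (intro exI[of _ "\<lambda>l. dot (v i) (b l)"]) (simp add: app_factorization[OF ab])
  qed
qed

text \<open>Greedy choice: as long as at most \<open>k\<close> columns have been chosen, they cannot
  span all columns, since that would give a decomposition into at most \<open>k\<close> outer
  products.\<close>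

lemma not_rank_le_columns:
  assumes "\<not> rank_le k B" shows "\<exists>\<sigma>. indep (Suc k) (\<lambda>l i. B i (\<sigma> l))"
proof -
  have "m \<le> Suc k \<Longrightarrow> \<exists>\<sigma>. indep m (\<lambda>l i. B i (\<sigma> l))" for m
  proof (induction m)
    case (Suc m)
    then obtain \<sigma> where \<sigma>: "indep m (\<lambda>l i. B i (\<sigma> l))" by auto
    have "\<not> rank_le m B" using assms Suc.prems rank_le_mono by auto
    then obtain j where j: "\<not> inspan m (\<lambda>l i. B i (\<sigma> l)) (\<lambda>i. B i j)"
      using rank_le_columns by blast
    have "indep (Suc m) (\<lambda>l i. B i ((\<sigma>(m := j)) l))"
    proof (rule indep_Suc)
      show "indep m (\<lambda>l i. B i ((\<sigma>(m := j)) l))"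
        using \<sigma> by (subst indep_cong[of m _ "\<lambda>l i. B i (\<sigma> l)"]) auto
      show "\<not> inspan m (\<lambda>l i. B i ((\<sigma>(m := j)) l)) (\<lambda>i. B i ((\<sigma>(m := j)) m))"
        using j by (subst inspan_cong[of m _ "\<lambda>l i. B i (\<sigma> l)"]) auto
    qed
    then show ?case by blast
  qed simp
  then show ?thesis by blast
qed

text \<open>For the least \<open>r\<close>, some \<open>r\<close> columns \<open>a l\<close> at
  positions \<open>\<sigma> l\<close> form a basis of the column space, and \<open>b l j\<close> is
  the coefficient of \<open>a l\<close> in column \<open>j\<close>. Column \<open>\<sigma> m\<close>
  is \<open>a m\<close> itself, so the rows \<open>b l\<close> are dual to the unit vectors at the
  \<open>\<sigma> m\<close>. This normal form makes pairings with the \<open>b l\<close> easy to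
  adjust.\<close>

lemma rank_factorization:
  fixes B :: "'k::field inf_mat"
  assumes "rank_le k B"
  obtains r a b \<sigma> where "r \<le> k" "indep r a"
    "\<And>l m. l < r \<Longrightarrow> m < r \<Longrightarrow> b l (\<sigma> m) = id_inf l m"
    "\<And>i j. B i j = (\<Sum>l<r. a l i * b l j)"
proof -
  define r where "r = (LEAST r. rank_le r B)"
  have r: "rank_le r B" "r \<le> k"
    using assms by (auto simp: r_def intro: LeastI Least_le)
  obtain \<sigma> where \<sigma>: "indep r (\<lambda>l i. B i (\<sigma> l))"
  proof (cases r)
    case (Suc q)
    then have "\<not> rank_le q B" using not_less_Least[of q "\<lambda>r. rank_le r B"] by (simp add: r_def)
    then show ?thesis using not_rank_le_columns that Suc by blast
  qed (use that in simp)
  define a where "a = (\<lambda>l i. B i (\<sigma> l))"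
  have a: "indep r a" using \<sigma> by (simp add: a_def)
  have "inspan r a (\<lambda>i. B i j)" for j
  proof (rule ccontr)
    assume n: "\<not> ?thesis"
    have "indep (Suc r) (\<lambda>l. app B (id_inf ((\<sigma>(r := j)) l)))"
    proof (rule indep_Suc)
      show "indep r (\<lambda>l. app B (id_inf ((\<sigma>(r := j)) l)))"
        using a by (subst indep_cong[of r _ a]) (auto simp: a_def app_unit)
      show "\<not> inspan r (\<lambda>l. app B (id_inf ((\<sigma>(r := j)) l))) (app B (id_inf ((\<sigma>(r := j)) r)))"
        using n by (subst inspan_cong[of r _ a]) (auto simp: a_def app_unit)
    qed
    then show False using rank_le_indep_bound[OF r(1)] by fastforce
  qed
  then obtain c where c: "\<And>i j. B i j = (\<Sum>l<r. c j l * a l i)"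
    unfolding inspan_def by metis
  show ?thesis
  proof (rule that[of r a "\<lambda>l j. c j l" \<sigma>])
    fix l m assume lm: "l < r" "m < r"
    have "c (\<sigma> m) l - id_inf l m = 0"
    proof (rule indepD[OF a _ lm(1), of "\<lambda>l. c (\<sigma> m) l - id_inf l m"])
      fix k
      have "(\<Sum>l<r. id_inf l m * a l k) = a m k"
        using lm by (simp add: id_inf_def if_distrib[of "\<lambda>c. c * _"] cong: if_cong)
      moreover have "(\<Sum>l<r. c (\<sigma> m) l * a l k) = a m k"
        by (simp add: c[symmetric]) (simp add: a_def)
      ultimately show "(\<Sum>l<r. (c (\<sigma> m) l - id_inf l m) * a l k) = 0"
        by (simp add: left_diff_distrib sum_subtractf)
    qed
    then show "c (\<sigma> m) l = id_inf l m" by simp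
  next
    fix i j show "B i j = (\<Sum>l<r. a l i * c j l)" using c[of i j] by (simp add: mult.commute)
  qed (use r a in auto)
qed

text \<open>The matrix with columns \<open>a l\<close> and rows \<open>b l\<close> sends
  \<open>v j\<close> to the combination of the \<open>a l\<close> with coefficients
  \<open>T l j\<close>. So images can be prescribed while the \<open>v j\<close> stay in general
  position: a unit vector far out is corrected by the unit vectors at the \<open>\<sigma> l\<close>,
  each of which changes a single pairing.\<close>

lemma kernel_vectors:
  fixes a :: "nat \<Rightarrow> nat \<Rightarrow> 'k::field"
  assumes "indep r a" "\<And>l m. l < r \<Longrightarrow> m < r \<Longrightarrow> b l (\<sigma> m) = id_inf l m"
  shows "\<exists>v. (\<forall>j<n. finsup (v j)) \<and> (\<forall>j<n. \<forall>l<r. dot (v j) (b l) = T l j) \<and>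
             indep (r + n) (\<lambda>i. if i < r then a i else v (i - r))"
proof (induction n)
  case 0
  have "indep r (\<lambda>i. if i < r then a i else undefined (i - r))"
    using assms(1) by (subst indep_cong[of r _ a]) auto
  then show ?case by auto
next
  case (Suc n)
  then obtain v where v: "\<And>j. j < n \<Longrightarrow> finsup (v j)"
    "\<And>j l. j < n \<Longrightarrow> l < r \<Longrightarrow> dot (v j) (b l) = T l j"
    "indep (r + n) (\<lambda>i. if i < r then a i else v (i - r))" by blast
  define x where "x i = (if i < r then a i else v (i - r))" for i
  define y where "y t = (if t < r + n then x t else id_inf (\<sigma> (t - (r + n))))" for t
  \<comment> \<open>The span to be avoided includes the unit vectors at the
    \<open>\<sigma> l\<close>, so that the correction in \<open>w\<close> cannot move the new vector
    back into the span of the old ones.\<close>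
  obtain i where i: "\<not> inspan (r + n + r) y (id_inf i)" using unit_not_inspan by blast
  define w where "w k = id_inf i k + (\<Sum>l<r. (T l n - b l i) * id_inf (\<sigma> l) k)" for k
  have w: "finsup w" "\<And>z. dot w z = z i + (\<Sum>l<r. (T l n - b l i) * z (\<sigma> l))"
    unfolding w_def
    using dot_affine_left[of "id_inf i" "{..<r}" "\<lambda>l. id_inf (\<sigma> l)" "\<lambda>l. T l n - b l i"] by simp_all
  have wb: "dot w (b m) = T m n" if "m < r" for m
  proof -
    have "(\<Sum>l<r. (T l n - b l i) * b m (\<sigma> l)) = (\<Sum>l<r. if l = m then T l n - b l i else 0)"
      by (rule sum.cong) (use assms(2) that in \<open>auto simp: id_inf_def\<close>)
    then show ?thesis using that by (simp add: w(2))
  qed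
  have nw: "\<not> inspan (r + n) x w"
  proof
    assume "inspan (r + n) x w"
    then have "inspan (r + n) y w" by (subst inspan_cong[of _ y x]) (auto simp: y_def)
    then have 1: "inspan (r + n + r) y w" by (rule inspan_mono) simp
    have "inspan (r + n + r) y (id_inf (\<sigma> l))" if "l < r" for l
      using inspan_base[of "r + n + l" "r + n + r" y] that by (simp add: y_def)
    then have "inspan (r + n + r) y (\<lambda>k. \<Sum>l<r. (T l n - b l i) * id_inf (\<sigma> l) k)"
      by (intro inspan_sum) auto
    from inspan_diff[OF 1 this] have "inspan (r + n + r) y (id_inf i)" by (simp add: w_def)
    with i show False by simp
  qed
  define v' where "v' = v(n := w)"
  have "indep (Suc (r + n)) (\<lambda>i. if i < r then a i else v' (i - r))"
  proof (rule indep_Suc)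
    show "indep (r + n) (\<lambda>i. if i < r then a i else v' (i - r))"
      using v(3) by (subst indep_cong[of _ _ x]) (auto simp: v'_def x_def[abs_def])
    show "\<not> inspan (r + n) (\<lambda>i. if i < r then a i else v' (i - r)) (if r + n < r then a (r + n) else v' (r + n - r))"
      using nw by (subst inspan_cong[of _ _ x]) (auto simp: v'_def x_def)
  qed
  moreover have "\<forall>j<Suc n. finsup (v' j)" "\<forall>j<Suc n. \<forall>l<r. dot (v' j) (b l) = T l j"
    using v(1,2) w(1) wb by (auto simp: v'_def less_Suc_eq)
  ultimately show ?case by (intro exI[of _ v']) auto
qed

text \<open>If every vector is an eigenvector, the map is scalar; here this is carried out modulo
  the span \<open>W\<close> of \<open>x\<close>. The eigenvalue of a fixed \<open>u0\<close> outside
  \<open>W\<close> is compared with that of \<open>z\<close> by means of \<open>u0 + z\<close>, for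
  \<open>z\<close> outside the span of \<open>W\<close> and \<open>u0\<close>.\<close>

lemma locally_scalar:
  fixes P :: "'k::field inf_mat"
  assumes "\<And>u. finsup u \<Longrightarrow> inspan m x u \<or> inspan (Suc m) (x(m := u)) (app P u)"
  shows "\<exists>c. \<forall>u. finsup u \<longrightarrow> inspan m x (\<lambda>k. app P u k - c * u k)"
proof -
  have eig: "\<exists>c. inspan m x (\<lambda>k. app P u k - c * u k)" if u: "finsup u" "\<not> inspan m x u" for u
  proof -
    obtain c where "\<And>k. app P u k = (\<Sum>i<Suc m. c i * (x(m := u)) i k)"
      using assms u unfolding inspan_def by blast
    then have "\<And>k. app P u k - c m * u k = (\<Sum>i<m. c i * x i k)" by simp
    then have "inspan m x (\<lambda>k. app P u k - c m * u k)" unfolding inspan_def by blast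
    then show ?thesis by blast
  qed
  obtain i0 where "\<not> inspan m x (id_inf i0)" using unit_not_inspan by blast
  then obtain u0 where u0: "finsup u0" "\<not> inspan m x u0" using finsup_unit by blast
  obtain c0 where c0: "inspan m x (\<lambda>k. app P u0 k - c0 * u0 k)" using eig u0 by blast
  let ?x = "x(m := u0)"
  have xx: "inspan (Suc m) ?x y" if "inspan m x y" for y
  proof (rule inspan_mono)
    show "inspan m ?x y" using that by (subst inspan_cong[of m _ x]) auto
  qed simp
  have xu: "inspan (Suc m) ?x u0" using inspan_base[of m "Suc m" ?x] by simp
  have key: "inspan m x (\<lambda>k. app P z k - c0 * z k)" if z: "finsup z" "\<not> inspan (Suc m) ?x z" for z
  proof -
    define s where "s k = u0 k + z k" for k
    have fs: "finsup s" unfolding s_def by (intro finsup_add u0 z)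
    have Ps: "app P s k = app P u0 k + app P z k" for k
      unfolding s_def by (intro app_add u0 z)
    have "\<not> inspan m x s"
    proof
      assume "inspan m x s"
      from inspan_diff[OF xx[OF this] xu] z(2) show False by (simp add: s_def)
    qed
    then obtain cs where cs: "inspan m x (\<lambda>k. app P s k - cs * s k)" using eig fs by blast
    obtain cz where cz: "inspan m x (\<lambda>k. app P z k - cz * z k)" using eig z xx by blast
    have "inspan m x (\<lambda>k. ((app P u0 k - c0 * u0 k) + 1 * (app P z k - cz * z k)) - (app P s k - cs * s k))"
      by (intro inspan_diff inspan_lincomb c0 cs cz)
    \<comment> \<open>Modulo \<open>W\<close> the vectors \<open>u0\<close> and \<open>z\<close> are
      independent, so both coefficients vanish and the three eigenvalues agree.\<close>
    then have d: "inspan m x (\<lambda>k. (cs - c0) * u0 k + (cs - cz) * z k)"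
      by (simp add: Ps) (simp add: s_def algebra_simps)
    have "cs = cz"
    proof (rule ccontr)
      assume "cs \<noteq> cz"
      have "inspan (Suc m) ?x (\<lambda>k. ((cs - c0) * u0 k + (cs - cz) * z k) - (cs - c0) * u0 k)"
        by (intro inspan_diff inspan_scale xx d xu)
      then have "inspan (Suc m) ?x (\<lambda>k. (cs - cz) * z k)" by simp
      then show False using inspan_scale_cancel[of _ _ "cs - cz" z] \<open>cs \<noteq> cz\<close> z(2) by auto
    qed
    with d have "inspan m x (\<lambda>k. (cs - c0) * u0 k)" by simp
    then have "cs = c0" using inspan_scale_cancel[of m x "cs - c0" u0] u0(2) by auto
    then show ?thesis using cz \<open>cs = cz\<close> by simp
  qed
  have "inspan m x (\<lambda>k. app P u k - c0 * u k)" if u: "finsup u" for u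
  proof -
    \<comment> \<open>Any \<open>u\<close>, even one in \<open>W\<close>, is a difference
      \<open>(u + e) - e\<close> with \<open>e\<close> a unit vector outside the span of
      \<open>W\<close>, \<open>u0\<close> and \<open>u\<close>; then \<open>key\<close> applies to
      both terms.\<close>
    obtain i where i: "\<not> inspan (Suc (Suc m)) (?x(Suc m := u)) (id_inf i)" using unit_not_inspan by blast
    have yy: "inspan (Suc (Suc m)) (?x(Suc m := u)) y" if "inspan (Suc m) ?x y" for y
    proof (rule inspan_mono)
      show "inspan (Suc m) (?x(Suc m := u)) y"
        using that by (subst inspan_cong[of "Suc m" _ ?x]) auto
    qed simp
    have yu: "inspan (Suc (Suc m)) (?x(Suc m := u)) u"
      using inspan_base[of "Suc m" "Suc (Suc m)" "?x(Suc m := u)"] by simp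
    have 1: "inspan m x (\<lambda>k. app P (id_inf i) k - c0 * id_inf i k)"
      using i yy by (intro key) auto
    have 2: "inspan m x (\<lambda>k. app P (\<lambda>k. u k + id_inf i k) k - c0 * (u k + id_inf i k))"
    proof (rule key)
      show "\<not> inspan (Suc m) ?x (\<lambda>k. u k + id_inf i k)"
      proof
        assume "inspan (Suc m) ?x (\<lambda>k. u k + id_inf i k)"
        from inspan_diff[OF yy[OF this] yu] i show False by simp
      qed
    qed (use u in simp)
    from inspan_diff[OF 2 1] show ?thesis
      by (simp add: app_add[OF u finsup_unit] algebra_simps)
  qed
  then show ?thesis by blast
qed

text \<open>Interleaved so that one more \<open>u\<close> appends two vectors at the end and leaves
  the initial segment of the family unchanged.\<close>

definition pairs :: "'k::field inf_mat \<Rightarrow> (nat \<Rightarrow> nat \<Rightarrow> 'k) \<Rightarrow> nat \<Rightarrow> nat \<Rightarrow> 'k" where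
  "pairs P u = (\<lambda>i. if even i then u (i div 2) else app P (u (i div 2)))"

lemma pairs_simps [simp]:
  "pairs P u (2 * i) = u i" "pairs P u (Suc (2 * i)) = app P (u i)"
  "pairs P u (i * 2) = u i" "pairs P u (Suc (i * 2)) = app P (u i)"
  by (simp_all add: pairs_def)

lemma sum_double: "(\<Sum>i<2 * n. h i) = (\<Sum>i<n. h (2 * i) + h (Suc (2 * i)))"
  for h :: "nat \<Rightarrow> 'a::comm_monoid_add"
  by (induction n) (simp_all add: add.assoc)

lemma sum_lessThan_plus: "(\<Sum>i<m + n. h i) = (\<Sum>i<m. h i) + (\<Sum>i<n. h (m + i))"
  for h :: "nat \<Rightarrow> 'a::comm_monoid_add"
  by (induction n) (simp_all add: add.assoc)

lemma id_inf_commute: "id_inf i j = id_inf j i"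
  by (simp add: id_inf_def)

text \<open>Take a system of \<open>m < n\<close> vectors that cannot be enlarged. Then for every
  \<open>w\<close> either \<open>w\<close> lies in its span, or \<open>P w\<close> lies in the span
  after \<open>w\<close> is added, so \<open>locally_scalar\<close> puts all columns of some
  \<open>P - c\<close> into a space spanned by \<open>2 * m\<close> vectors.\<close>

lemma scalar_plus_rank_le:
  assumes "\<nexists>u. (\<forall>i<n. finsup (u i)) \<and> indep (2 * n) (pairs P u)"
  shows "\<exists>c. rank_le (2 * n) (shift P c)"
  using assms
proof (induction n)
  case (Suc m)
  show ?case
  proof (cases "\<exists>u. (\<forall>i<m. finsup (u i)) \<and> indep (2 * m) (pairs P u)")
    case False
    then obtain c where "rank_le (2 * m) (shift P c)" using Suc.IH by blast
    then show ?thesis using rank_le_mono[of "2 * m" _ "2 * Suc m"] by auto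
  next
    case True
    then obtain u where u: "\<And>i. i < m \<Longrightarrow> finsup (u i)" "indep (2 * m) (pairs P u)" by blast
    have "\<exists>c. \<forall>w. finsup w \<longrightarrow> inspan (2 * m) (pairs P u) (\<lambda>k. app P w k - c * w k)"
    proof (rule locally_scalar, rule ccontr)
      fix w assume w: "finsup w"
        "\<not> (inspan (2 * m) (pairs P u) w \<or> inspan (Suc (2 * m)) ((pairs P u)(2 * m := w)) (app P w))"
      define u' where "u' = u(m := w)"
      have eq: "pairs P u' i = pairs P u i" if "i < 2 * m" for i
        using that by (auto simp: pairs_def u'_def)
      have top: "pairs P u' (2 * m) = w" "pairs P u' (Suc (2 * m)) = app P w"
        by (simp_all add: u'_def)
      have "indep (Suc (2 * m)) (pairs P u')"
      proof (rule indep_Suc)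
        show "indep (2 * m) (pairs P u')" using u(2) by (subst indep_cong[OF eq]) auto
        show "\<not> inspan (2 * m) (pairs P u') (pairs P u' (2 * m))"
          unfolding top using w(2) by (subst inspan_cong[OF eq]) auto
      qed
      then have "indep (Suc (Suc (2 * m))) (pairs P u')"
      proof (rule indep_Suc)
        have "inspan (Suc (2 * m)) (pairs P u') = inspan (Suc (2 * m)) ((pairs P u)(2 * m := w))"
          by (rule inspan_cong) (use eq top in \<open>auto simp: less_Suc_eq\<close>)
        then show "\<not> inspan (Suc (2 * m)) (pairs P u') (pairs P u' (Suc (2 * m)))"
          unfolding top using w(2) by simp
      qed
      moreover have "\<forall>i<Suc m. finsup (u' i)" using u w by (auto simp: u'_def less_Suc_eq)
      ultimately show False using Suc.prems by auto
    qed
    then obtain c where c: "\<And>w. finsup w \<Longrightarrow> inspan (2 * m) (pairs P u) (\<lambda>k. app P w k - c * w k)"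
      by blast
    have "rank_le (2 * m) (shift P c)"
    proof (rule rank_le_columns)
      fix j show "inspan (2 * m) (pairs P u) (\<lambda>i. shift P c i j)"
        using c[of "id_inf j"] by (simp add: app_unit shift_def id_inf_commute[of j])
    qed
    then show ?thesis using rank_le_mono[of "2 * m" _ "2 * Suc m"] by auto
  qed
qed (simp)

text \<open>The source of arbitrary blocks: as the \<open>u j\<close> and the \<open>P (u j)\<close>
  are jointly independent, the values on the former can be those of a dual basis while the values on
  the latter are free. The numbers \<open>dot (f i) (app P (u j))\<close> will be the block of a
  conjugate of \<open>P\<close>.\<close>

lemma pairs_functionals:
  assumes "indep (2 * n) (pairs P u)"
  shows "\<exists>f. (\<forall>i<n. finsup (f i)) \<and>
    (\<forall>i<n. \<forall>j<n. dot (f i) (u j) = id_inf i j \<and> dot (f i) (app P (u j)) = Q i j)"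
proof -
  obtain g where g: "\<And>i. i < 2 * n \<Longrightarrow> finsup (g i)"
    "\<And>i j. i < 2 * n \<Longrightarrow> j < 2 * n \<Longrightarrow> dot (g i) (pairs P u j) = id_inf i j"
    using dual_family[OF assms] by blast
  define f where "f = (\<lambda>i k. g (2 * i) k + (\<Sum>l<n. Q i l * g (Suc (2 * l)) k))"
  have f: "finsup (f i)" "dot (f i) x = dot (g (2 * i)) x + (\<Sum>l<n. Q i l * dot (g (Suc (2 * l))) x)"
    if "i < n" for i x
    using dot_affine_left[of "g (2 * i)" "{..<n}" "\<lambda>l. g (Suc (2 * l))" "Q i"] g(1) that
    by (auto simp: f_def)
  have par: "Suc (2 * l) \<noteq> 2 * j" "2 * j \<noteq> Suc (2 * l)" for l j :: nat
    by presburger+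
  have "dot (f i) (u j) = id_inf i j \<and> dot (f i) (app P (u j)) = Q i j" if "i < n" "j < n" for i j
  proof
    have "dot (g l) (u j) = id_inf l (2 * j)" if "l < 2 * n" for l
      using g(2)[of l "2 * j"] that \<open>j < n\<close> by simp
    then show "dot (f i) (u j) = id_inf i j"
      using that by (simp add: f id_inf_def par)
    have *: "dot (g l) (app P (u j)) = id_inf l (Suc (2 * j))" if "l < 2 * n" for l
      using g(2)[of l "Suc (2 * j)"] that \<open>j < n\<close> by simp
    have "(\<Sum>l<n. Q i l * dot (g (Suc (2 * l))) (app P (u j))) = (\<Sum>l<n. if l = j then Q i l else 0)"
      by (rule sum.cong) (auto simp: * id_inf_def)
    moreover have "dot (g (2 * i)) (app P (u j)) = 0"
      using that by (simp add: * id_inf_def par)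
    ultimately show "dot (f i) (app P (u j)) = Q i j" using that by (simp add: f)
  qed
  then show ?thesis using f(1) by blast
qed

text \<open>
  For each \<open>u\<close> the condition on the right is polynomial in the entries of \<open>P\<close>, so the set on the
  left is closed over any field, with no quantifier over \<open>c\<close> to eliminate.
\<close>

lemma scalar_plus_rank_le_iff:
  "(\<exists>c. rank_le k (shift P c)) \<longleftrightarrow>
   (\<forall>u. (\<forall>i<Suc k. finsup (u i)) \<longrightarrow> \<not> indep (2 * Suc k) (pairs P u))"
proof (intro iffI allI impI notI)
  fix u assume "\<exists>c. rank_le k (shift P c)" and u: "\<forall>i<Suc k. finsup (u i)"
    and ind: "indep (2 * Suc k) (pairs P u)"
  then obtain c where c: "rank_le k (shift P c)" by blast
  have "indep (Suc k) (\<lambda>i. app (shift P c) (u i))"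
    unfolding indep_def
  proof (intro allI impI)
    fix d i assume d: "\<forall>j. (\<Sum>i<Suc k. d i * app (shift P c) (u i) j) = 0" and i: "i < Suc k"
    \<comment> \<open>A relation among the \<open>(P - c) (u i)\<close> with coefficients
      \<open>d i\<close> becomes one in the interleaved system, with \<open>- c * d i\<close> at
      \<open>u i\<close> and \<open>d i\<close> at \<open>P (u i)\<close>.\<close>
    define e where "e t = (if even t then - c * d (t div 2) else d (t div 2))" for t
    have "(\<Sum>t<2 * Suc k. e t * pairs P u t j) = 0" for j
    proof -
      have "(\<Sum>t<2 * Suc k. e t * pairs P u t j) =
        (\<Sum>i<Suc k. e (2 * i) * pairs P u (2 * i) j + e (Suc (2 * i)) * pairs P u (Suc (2 * i)) j)"
        by (rule sum_double)
      also have "\<dots> = (\<Sum>i<Suc k. d i * app (shift P c) (u i) j)"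
        by (rule sum.cong) (use u in \<open>auto simp: e_def app_shift algebra_simps\<close>)
      finally show ?thesis using d by simp
    qed
    then have "e (Suc (2 * i)) = 0" using indepD[OF ind, of e "Suc (2 * i)"] i by simp
    then show "d i = 0" by (simp add: e_def)
  qed
  from rank_le_indep_bound[OF c this] show False by simp
next
  assume no: "\<forall>u. (\<forall>i<Suc k. finsup (u i)) \<longrightarrow> \<not> indep (2 * Suc k) (pairs P u)"
  \<comment> \<open>The coarse bound serves only to make \<open>P - c\<close> of finite rank; its
    exact rank \<open>r\<close> is then compared with \<open>k\<close>.\<close>
  then obtain c where "rank_le (2 * Suc k) (shift P c)" using scalar_plus_rank_le[of "Suc k" P] by blast
  then obtain r a b \<sigma> where "r \<le> 2 * Suc k" and B: "indep r a"
    "\<And>l m. l < r \<Longrightarrow> m < r \<Longrightarrow> b l (\<sigma> m) = id_inf l m"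
    "\<And>i j. shift P c i j = (\<Sum>l<r. a l i * b l j)"
    using rank_factorization[of "2 * Suc k" "shift P c"] by blast
  show "\<exists>c. rank_le k (shift P c)"
  proof (cases "r \<le> k")
    case True
    have "rank_le r (shift P c)" unfolding rank_le_def using B(3) by blast
    then show ?thesis using True rank_le_mono by blast
  next
    case False
    define n where "n = Suc k"
    have n: "n \<le> r" using False by (simp add: n_def)
    \<comment> \<open>With \<open>T\<close> the identity, \<open>P - c\<close> sends
      \<open>v j\<close> to \<open>a j\<close>, so \<open>P (v j)\<close> is
      \<open>a j + c * v j\<close>. As the \<open>v j\<close> are independent of the
      \<open>a l\<close>, these \<open>k + 1 \<le> r\<close> vectors violate the assumption.\<close>
    obtain v where v: "\<And>j. j < n \<Longrightarrow> finsup (v j)"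
      "\<And>j l. j < n \<Longrightarrow> l < r \<Longrightarrow> dot (v j) (b l) = id_inf l j"
      "indep (r + n) (\<lambda>i. if i < r then a i else v (i - r))"
      using kernel_vectors[of r a b \<sigma> n id_inf, OF B(1,2)] by blast
    have Pv: "app P (v j) i = a j i + c * v j i" if "j < n" for i j
    proof -
      have "app (shift P c) (v j) i = (\<Sum>l<r. id_inf l j * a l i)"
        using that by (simp add: app_factorization[OF B(3)] v)
      also have "\<dots> = a j i"
        using that n by (simp add: id_inf_def if_distrib[of "\<lambda>c. c * _"] cong: if_cong)
      finally show ?thesis using app_shift[OF v(1)[OF that], of P c i] by (simp add: algebra_simps)
    qed
    have "indep (2 * n) (pairs P v)" unfolding indep_def
    proof (intro allI impI)
      fix e t assume e: "\<forall>k. (\<Sum>t<2 * n. e t * pairs P v t k) = 0" and t: "t < 2 * n"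
      \<comment> \<open>Base change: \<open>d\<close> lists the coefficients of the relation in
        terms of the \<open>a i\<close> and the \<open>v i\<close>; the \<open>a i\<close> with
        \<open>n \<le> i\<close> do not occur.\<close>
      define d where "d i = (if i < r then (if i < n then e (Suc (2 * i)) else 0)
        else e (2 * (i - r)) + c * e (Suc (2 * (i - r))))" for i
      have "(\<Sum>i<r + n. d i * (if i < r then a i else v (i - r)) k) = 0" for k
      proof -
        have "(\<Sum>i<r + n. d i * (if i < r then a i else v (i - r)) k) =
          (\<Sum>i<r. d i * a i k) + (\<Sum>i<n. d (r + i) * v i k)"
          by (simp add: sum_lessThan_plus)
        also have "(\<Sum>i<r. d i * a i k) = (\<Sum>i<n. e (Suc (2 * i)) * a i k)"
          by (rule sum.mono_neutral_cong_right) (use n in \<open>auto simp: d_def\<close>)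
        also have "\<dots> + (\<Sum>i<n. d (r + i) * v i k) = (\<Sum>i<n. e (2 * i) * v i k + e (Suc (2 * i)) * app P (v i) k)"
          unfolding sum.distrib[symmetric] by (rule sum.cong) (auto simp: d_def Pv algebra_simps)
        also have "\<dots> = (\<Sum>t<2 * n. e t * pairs P v t k)" by (simp add: sum_double)
        finally show ?thesis using e by simp
      qed
      then have d0: "d i = 0" if "i < r + n" for i
        using indepD[OF v(3), of d i] that by blast
      have odd: "e (Suc (2 * i)) = 0" if "i < n" for i
        using d0[of i] that n by (simp add: d_def)
      have even: "e (2 * i) = 0" if "i < n" for i
        using d0[of "r + i"] that odd[of i] by (simp add: d_def)
      show "e t = 0"
      proof (cases "even t")
        case True
        then show ?thesis using even t by (auto elim!: evenE)
      next
        case False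
        then show ?thesis using odd t by (auto elim!: oddE)
      qed
    qed
    then show ?thesis using no v(1) by (simp add: n_def)
  qed
qed

lemma rank_le_iff_indep:
  "rank_le k B \<longleftrightarrow> (\<forall>\<sigma>. \<not> indep (Suc k) (\<lambda>l. app B (id_inf (\<sigma> l))))"
proof
  assume "rank_le k B"
  then show "\<forall>\<sigma>. \<not> indep (Suc k) (\<lambda>l. app B (id_inf (\<sigma> l)))"
    using rank_le_indep_bound[of k B "Suc k"] by fastforce
next
  assume "\<forall>\<sigma>. \<not> indep (Suc k) (\<lambda>l. app B (id_inf (\<sigma> l)))"
  then show "rank_le k B" using not_rank_le_columns[of k B] by (auto simp: app_unit)
qed

section \<open>Comparison with the ranks of finite blocks\<close>

lemma vec_space_rank_le:
  fixes B :: "'k::field inf_mat"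
  assumes "\<And>i j. B i j = (\<Sum>l<k. a l i * b l j)"
  shows "vec_space.rank n (pr n B) \<le> k"
proof -
  interpret vec_space "TYPE('k)" n .
  have "rank (pr n (\<lambda>i j. \<Sum>l<k. a l i * b l j)) \<le> k"
  proof (induction k)
    case 0
    have "pr n (\<lambda>i j. \<Sum>l<0. a l i * b l j) = 0\<^sub>m n n" by (rule eq_matI) (auto simp: pr_def)
    then show ?case by (simp add: rank_0I)
  next
    case (Suc k)
    have "pr n (\<lambda>i j. \<Sum>l<Suc k. a l i * b l j) =
      pr n (\<lambda>i j. \<Sum>l<k. a l i * b l j) + pr n (\<lambda>i j. a k i * b k j)"
      by (rule eq_matI) (auto simp: pr_def)
    moreover have "rank (pr n (\<lambda>i j. \<Sum>l<k. a l i * b l j) + pr n (\<lambda>i j. a k i * b k j))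
      \<le> rank (pr n (\<lambda>i j. \<Sum>l<k. a l i * b l j)) + rank (pr n (\<lambda>i j. a k i * b k j))"
      by (rule rank_subadditive[of _ n]) (auto simp: pr_def)
    moreover have "rank (pr n (\<lambda>i j. a k i * b k j)) \<le> 1"
      by (rule rank_le_1_product_entries[of _ n "a k" "b k"]) (auto simp: pr_def)
    ultimately show ?case using Suc.IH by simp
  qed
  moreover have "B = (\<lambda>i j. \<Sum>l<k. a l i * b l j)" using assms by auto
  ultimately show ?thesis by simp
qed

text \<open>Independence of infinitely long columns is witnessed by dual functionals of finite
  support, so it survives truncation to a block containing all these supports and all the chosen
  columns.\<close>

lemma vec_space_rank_ge:
  fixes B :: "'k::field inf_mat"
  assumes "indep m (\<lambda>l i. B i (\<sigma> l))"
  shows "\<exists>n\<ge>1. m \<le> vec_space.rank n (pr n B)"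
proof -
  obtain f where f: "\<And>i. i < m \<Longrightarrow> finsup (f i)"
    "\<And>i j. i < m \<Longrightarrow> j < m \<Longrightarrow> dot (f i) (\<lambda>k. B k (\<sigma> j)) = id_inf i j"
    using dual_family[OF assms] by auto
  obtain N where N: "\<And>i k. i < m \<Longrightarrow> k \<ge> N \<Longrightarrow> f i k = 0"
    using finsup_common[of m f] f(1) by blast
  define n where "n = Suc (max N (Max (insert 0 (\<sigma> ` {..<m}))))"
  have \<sigma>0: "\<sigma> j \<le> Max (insert 0 (\<sigma> ` {..<m}))" if "j < m" for j
    using that by (intro Max_ge) auto
  have \<sigma>: "\<sigma> j < n" if "j < m" for j
    using \<sigma>0[OF that] by (simp add: n_def less_Suc_eq_le le_max_iff_disj)
  have fN: "dot (f i) x = (\<Sum>k<n. f i k * x k)" if "i < m" for i x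
    by (rule dot_eq) (use N that in \<open>auto simp: n_def\<close>)
  interpret vec_space "TYPE('k)" n .
  define A where "A = mat n m (\<lambda>(i, j). B i (\<sigma> j))"
  have A: "A \<in> carrier_mat n m" by (simp add: A_def)
  have inj: "c = 0\<^sub>v m" if c: "c \<in> carrier_vec m" "A *\<^sub>v c = 0\<^sub>v n" for c
  proof (rule eq_vecI)
    fix i assume i: "i < dim_vec (0\<^sub>v m :: 'k vec)"
    have row: "(\<Sum>j<m. B k (\<sigma> j) * c $ j) = 0" if "k < n" for k
    proof -
      have "(A *\<^sub>v c) $ k = (\<Sum>j<m. B k (\<sigma> j) * c $ j)"
        using that c(1) by (simp add: A_def scalar_prod_def atLeast0LessThan)
      then show ?thesis using c(2) that by simp
    qed
    have "c $ i = (\<Sum>j<m. id_inf i j * c $ j)"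
      using i by (simp add: id_inf_def if_distrib[of "\<lambda>c. c * _"] cong: if_cong)
    also have "\<dots> = (\<Sum>j<m. (\<Sum>k<n. f i k * B k (\<sigma> j)) * c $ j)"
      by (rule sum.cong) (use i f(2) fN in auto)
    also have "\<dots> = (\<Sum>k<n. f i k * (\<Sum>j<m. B k (\<sigma> j) * c $ j))"
      by (simp add: sum_distrib_left sum_distrib_right mult.assoc) (rule sum.swap)
    also have "\<dots> = 0" using row by simp
    finally show "c $ i = 0\<^sub>v m $ i" using i by simp
  qed (use c in simp)
  \<comment> \<open>The rank is bounded below through a set of columns, so the truncated columns
    must also be pairwise distinct for the count to be \<open>m\<close>.\<close>
  have dist: "distinct (cols A)"
    unfolding distinct_conv_nth
  proof (intro allI impI notI)
    fix p q assume pq: "p < length (cols A)" "q < length (cols A)" "p \<noteq> q" "cols A ! p = cols A ! q"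
    then have pm: "p < m" "q < m" using A by auto
    have c: "B k (\<sigma> p) = B k (\<sigma> q)" if "k < n" for k
    proof -
      have "col A p $ k = col A q $ k" using pq A by simp
      then show ?thesis using that pm by (simp add: A_def)
    qed
    have "id_inf p p = (id_inf p q :: 'k)"
      unfolding f(2)[OF pm(1) pm(1), symmetric] f(2)[OF pm, symmetric] fN[OF pm(1)]
      by (rule sum.cong) (auto simp: c)
    then show False using pq(3) by (simp add: id_inf_def)
  qed
  have li: "lin_indpt (set (cols A))"
    using lin_depE[OF A _ dist] inj by metis
  have sub: "set (cols A) \<subseteq> set (cols (pr n B))"
  proof
    fix w assume "w \<in> set (cols A)"
    then obtain j where j: "j < m" "w = col A j" using A by (auto simp: cols_def)
    have "w = col (pr n B) (\<sigma> j)"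
      by (rule eq_vecI) (use j \<sigma> in \<open>auto simp: A_def pr_def\<close>)
    then show "w \<in> set (cols (pr n B))" using \<sigma>[OF j(1)] by (auto simp: cols_def pr_def)
  qed
  have "card (set (cols A)) \<le> rank (pr n B)"
    by (rule rank_ge_card_indpt[OF _ sub li, of n]) (simp add: pr_def)
  moreover have "card (set (cols A)) = m"
    using distinct_card[OF dist] A by simp
  ultimately show ?thesis by (intro exI[of _ n]) (simp add: n_def)
qed

lemma rk_inf_le_iff: "rk_inf B \<le> enat k \<longleftrightarrow> rank_le k B"
proof
  assume "rank_le k B"
  then obtain a b where "\<And>i j. B i j = (\<Sum>l<k. a l i * b l j)" unfolding rank_le_def by blast
  from vec_space_rank_le[OF this] show "rk_inf B \<le> enat k"
    unfolding rk_inf_def by (intro SUP_least) simp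
next
  assume le: "rk_inf B \<le> enat k"
  show "rank_le k B"
  proof (rule ccontr)
    assume "\<not> rank_le k B"
    then obtain \<sigma> where "indep (Suc k) (\<lambda>l i. B i (\<sigma> l))" using not_rank_le_columns by blast
    from vec_space_rank_ge[of "Suc k" B \<sigma>, OF this] obtain n where n: "n \<ge> 1" "Suc k \<le> vec_space.rank n (pr n B)" by blast
    have "enat (vec_space.rank n (pr n B)) \<le> rk_inf B"
      unfolding rk_inf_def by (rule SUP_upper) (use n in simp)
    also note le
    finally show False using n(2) by simp
  qed
qed

lemma not_rank_le_id: "\<not> rank_le k id_inf"
proof
  assume "rank_le k (id_inf :: 'k::field inf_mat)"
  moreover have "indep (Suc k) (\<lambda>i. app (id_inf :: 'k inf_mat) (id_inf i))"
  proof -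
    have "app (id_inf :: 'k inf_mat) (id_inf i) = id_inf i" for i
      unfolding app_unit by (simp add: id_inf_def fun_eq_iff)
    then show ?thesis using indep_unit by simp
  qed
  ultimately show False using rank_le_indep_bound by fastforce
qed

lemma rank_le_scale: assumes "rank_le k B" shows "rank_le k (\<lambda>i j. c * B i j)"
proof -
  obtain a b where "\<And>i j. B i j = (\<Sum>l<k. a l i * b l j)" using assms unfolding rank_le_def by blast
  then show ?thesis unfolding rank_le_def
    by (intro exI[of _ "\<lambda>l i. c * a l i"] exI[of _ b]) (simp add: sum_distrib_left mult.assoc)
qed

text \<open>The infimum is attained because \<open>enat\<close> is well ordered. At a minimiser of
  rank at most \<open>k\<close> the coefficient of \<open>P\<close> is nonzero, as the identity has
  infinite rank, and dividing by it leaves some \<open>P - c\<close>.\<close>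

lemma rk_tuple_le_iff:
  fixes P :: "'k::field inf_mat"
  shows "rk_tuple_inf [P, id_inf] \<le> enat k \<longleftrightarrow> (\<exists>c. rank_le k (shift P c))"
proof -
  have comb: "(\<lambda>i j. \<Sum>l<length [P, id_inf]. \<mu> l * ([P, id_inf] ! l) i j) = (\<lambda>i j. \<mu> 0 * P i j + \<mu> 1 * id_inf i j)"
    for \<mu> :: "nat \<Rightarrow> 'k"
    by (simp add: lessThan_Suc add.commute)
  let ?S = "{\<mu> :: nat \<Rightarrow> 'k. \<exists>l<length [P, id_inf]. \<mu> l \<noteq> 0}"
  let ?r = "\<lambda>\<mu>. rk_inf (\<lambda>i j. \<mu> 0 * P i j + \<mu> 1 * id_inf i j)"
  have eq: "rk_tuple_inf [P, id_inf] = (INF \<mu>\<in>?S. ?r \<mu>)"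
    unfolding rk_tuple_inf_def comb ..
  show ?thesis
  proof
    assume le: "rk_tuple_inf [P, id_inf] \<le> enat k"
    have "?r (\<lambda>_. 1) \<in> ?r ` ?S" by (rule imageI) auto
    then have "(INF \<mu>\<in>?S. ?r \<mu>) \<in> ?r ` ?S" by (rule wellorder_InfI)
    then obtain \<mu> where \<mu>: "(INF \<mu>\<in>?S. ?r \<mu>) = ?r \<mu>" "\<mu> \<in> ?S" by (rule imageE)
    have "?r \<mu> \<le> enat k" using le by (simp only: eq \<mu>(1))
    then have rl: "rank_le k (\<lambda>i j. \<mu> 0 * P i j + \<mu> 1 * id_inf i j)" by (simp add: rk_inf_le_iff)
    have "\<mu> 0 \<noteq> 0"
    proof
      assume 0: "\<mu> 0 = 0"
      then have "\<mu> 1 \<noteq> 0" using \<mu>(2) by (auto simp: less_Suc_eq)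
      then have "rank_le k (id_inf :: 'k inf_mat)"
        using rank_le_scale[OF rl, of "1 / \<mu> 1"] 0 by simp
      with not_rank_le_id show False by blast
    qed
    then have "(\<lambda>i j. (1 / \<mu> 0) * (\<mu> 0 * P i j + \<mu> 1 * id_inf i j)) = shift P (- \<mu> 1 / \<mu> 0)"
      by (simp add: shift_def fun_eq_iff field_simps)
    with rank_le_scale[OF rl, of "1 / \<mu> 0"] show "\<exists>c. rank_le k (shift P c)" by metis
  next
    assume "\<exists>c. rank_le k (shift P c)"
    then obtain c where c: "rank_le k (shift P c)" by blast
    let ?\<mu> = "\<lambda>l::nat. if l = 0 then 1 else - c"
    have "(INF \<mu>\<in>?S. ?r \<mu>) \<le> ?r ?\<mu>" by (rule INF_lower) auto
    also have "\<dots> \<le> enat k" using c by (simp add: rk_inf_le_iff shift_def)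
    finally show "rk_tuple_inf [P, id_inf] \<le> enat k" unfolding eq .
  qed
qed

section \<open>Closed sets and polynomial curves\<close>

text \<open>Generated inductively so that closure properties and restriction to curves become
  inductions, free of bookkeeping with exponents; all levels \<open>n\<close> act on the same
  infinite matrices.\<close>

inductive block_poly :: "nat \<Rightarrow> ('k::field inf_mat \<Rightarrow> 'k) \<Rightarrow> bool" for n where
  const: "block_poly n (\<lambda>P. c)"
| entry: "i < n \<Longrightarrow> j < n \<Longrightarrow> block_poly n (\<lambda>P. P i j)"
| add: "block_poly n f \<Longrightarrow> block_poly n g \<Longrightarrow> block_poly n (\<lambda>P. f P + g P)"
| mult: "block_poly n f \<Longrightarrow> block_poly n g \<Longrightarrow> block_poly n (\<lambda>P. f P * g P)"

lemma block_poly_mono: "block_poly n f \<Longrightarrow> n \<le> m \<Longrightarrow> block_poly m f"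
  by (induction rule: block_poly.induct) (auto intro: block_poly.intros)

lemma block_poly_sum: "(\<And>i. i \<in> I \<Longrightarrow> block_poly n (f i)) \<Longrightarrow> block_poly n (\<lambda>P. \<Sum>i\<in>I. f i P)"
  by (induction I rule: infinite_finite_induct) (auto intro: block_poly.intros)

lemma block_poly_prod: "(\<And>i. i \<in> I \<Longrightarrow> block_poly n (f i)) \<Longrightarrow> block_poly n (\<lambda>P. \<Prod>i\<in>I. f i P)"
  by (induction I rule: infinite_finite_induct) (auto intro: block_poly.intros)

lemma block_poly_power: "block_poly n f \<Longrightarrow> block_poly n (\<lambda>P. f P ^ e)"
  by (induction e) (auto intro: block_poly.intros)

text \<open>\<open>polynomial_function\<close> sums over a set of distinct exponent families, so
  equal monomials that arise in sums and products have to be collected. Here any finite index set is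
  allowed, and coefficients are added over the fibres of \<open>e\<close>.\<close>

lemma polynomial_functionI:
  fixes e :: "'i \<Rightarrow> nat \<times> nat \<Rightarrow> nat"
  assumes "finite I" "\<And>A. h A = (\<Sum>i\<in>I. d i * (\<Prod>ij\<in>{..<n} \<times> {..<n}. (A $$ ij) ^ e i ij))"
  shows "polynomial_function n h"
proof -
  let ?mon = "\<lambda>m A. \<Prod>ij\<in>{..<n} \<times> {..<n}. (A $$ ij) ^ m ij"
  have "h A = (\<Sum>m\<in>e ` I. (\<Sum>i | i \<in> I \<and> e i = m. d i) * ?mon m A)" for A
  proof -
    have "h A = (\<Sum>m\<in>e ` I. \<Sum>i | i \<in> I \<and> e i = m. d i * ?mon (e i) A)"
      unfolding assms(2) by (rule sum.image_gen[OF assms(1)])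
    also have "\<dots> = (\<Sum>m\<in>e ` I. (\<Sum>i | i \<in> I \<and> e i = m. d i) * ?mon m A)"
      unfolding sum_distrib_right by (intro sum.cong refl) auto
    finally show ?thesis .
  qed
  then have "h = (\<lambda>A. \<Sum>m\<in>e ` I. (\<Sum>i | i \<in> I \<and> e i = m. d i) * ?mon m A)" by blast
  then show ?thesis unfolding polynomial_function_def
    by (intro exI[of _ "e ` I"] exI[of _ "\<lambda>m. \<Sum>i | i \<in> I \<and> e i = m. d i"])
       (use assms(1) in blast)
qed

lemma polynomial_function_const: "polynomial_function n (\<lambda>A. c)"
  by (rule polynomial_functionI[of "{()}" _ "\<lambda>_. c" "\<lambda>_ _. 0" n]) simp_all

lemma polynomial_function_entry:
  assumes "i < n" "j < n" shows "polynomial_function n (\<lambda>A. A $$ (i, j))"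
proof (rule polynomial_functionI[of "{()}" _ "\<lambda>_. 1" "\<lambda>_ p. if p = (i, j) then 1 else 0" n])
  fix A :: "'a mat"
  have "(\<Prod>p\<in>{..<n} \<times> {..<n}. A $$ p ^ (if p = (i, j) then 1 else 0)) =
    (\<Prod>p\<in>{..<n} \<times> {..<n}. if p = (i, j) then A $$ p else 1)"
    by (rule prod.cong) auto
  also have "\<dots> = A $$ (i, j)" using assms by (subst prod.delta) auto
  finally show "A $$ (i, j) = (\<Sum>_\<in>{()}. 1 *
      (\<Prod>p\<in>{..<n} \<times> {..<n}. A $$ p ^ (if p = (i, j) then 1 else 0)))"
    by simp
qed simp

lemma polynomial_function_add:
  assumes "polynomial_function n f" "polynomial_function n g"
  shows "polynomial_function n (\<lambda>A. f A + g A)"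
proof -
  obtain M c where f: "finite M" "f = (\<lambda>A. \<Sum>m\<in>M. c m * (\<Prod>ij\<in>{..<n} \<times> {..<n}. (A $$ ij) ^ m ij))"
    using assms(1) unfolding polynomial_function_def by blast
  obtain N d where g: "finite N" "g = (\<lambda>A. \<Sum>m\<in>N. d m * (\<Prod>ij\<in>{..<n} \<times> {..<n}. (A $$ ij) ^ m ij))"
    using assms(2) unfolding polynomial_function_def by blast
  show ?thesis
    by (rule polynomial_functionI[of "M <+> N" _ "case_sum c d" "case_sum id id" n])
       (use f(1) g(1) in \<open>simp_all add: f(2) g(2) sum.Plus\<close>)
qed

lemma polynomial_function_mult:
  assumes "polynomial_function n f" "polynomial_function n g"
  shows "polynomial_function n (\<lambda>A. f A * g A)"
proof -
  obtain M c where f: "finite M" "f = (\<lambda>A. \<Sum>m\<in>M. c m * (\<Prod>ij\<in>{..<n} \<times> {..<n}. (A $$ ij) ^ m ij))"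
    using assms(1) unfolding polynomial_function_def by blast
  obtain N d where g: "finite N" "g = (\<lambda>A. \<Sum>m\<in>N. d m * (\<Prod>ij\<in>{..<n} \<times> {..<n}. (A $$ ij) ^ m ij))"
    using assms(2) unfolding polynomial_function_def by blast
  show ?thesis
  proof (rule polynomial_functionI[of "M \<times> N" _ "\<lambda>(p, q). c p * d q" "\<lambda>(p, q) ij. p ij + q ij" n])
    fix A
    show "f A * g A = (\<Sum>i\<in>M \<times> N. (case i of (p, q) \<Rightarrow> c p * d q) *
        (\<Prod>ij\<in>{..<n} \<times> {..<n}. A $$ ij ^ (case i of (p, q) \<Rightarrow> \<lambda>ij. p ij + q ij) ij))"
      unfolding f(2) g(2) sum_product sum.cartesian_product
      by (intro sum.cong refl) (auto simp: power_add prod.distrib mult_ac)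
  qed (use f(1) g(1) in simp)
qed

lemma block_poly_iff:
  fixes f :: "'k::field inf_mat \<Rightarrow> 'k"
  shows "block_poly n f \<longleftrightarrow> (\<exists>h. polynomial_function n h \<and> f = (\<lambda>P. h (pr n P)))"
proof
  assume "block_poly n f"
  then show "\<exists>h. polynomial_function n h \<and> f = (\<lambda>P. h (pr n P))"
  proof (induction rule: block_poly.induct)
    case (const c)
    then show ?case by (intro exI[of _ "\<lambda>_. c"]) (simp add: polynomial_function_const)
  next
    case (entry i j)
    then show ?case by (intro exI[of _ "\<lambda>A. A $$ (i, j)"]) (simp add: polynomial_function_entry pr_def)
  next
    case (add f g)
    then obtain h h' where "polynomial_function n h" "polynomial_function n h'"
      "f = (\<lambda>P. h (pr n P))" "g = (\<lambda>P. h' (pr n P))" by blast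
    then show ?case by (intro exI[of _ "\<lambda>A. h A + h' A"]) (simp add: polynomial_function_add)
  next
    case (mult f g)
    then obtain h h' where "polynomial_function n h" "polynomial_function n h'"
      "f = (\<lambda>P. h (pr n P))" "g = (\<lambda>P. h' (pr n P))" by blast
    then show ?case by (intro exI[of _ "\<lambda>A. h A * h' A"]) (simp add: polynomial_function_mult)
  qed
next
  assume "\<exists>h. polynomial_function n h \<and> f = (\<lambda>P. h (pr n P))"
  then obtain M c where f: "f = (\<lambda>P. \<Sum>m\<in>M. c m * (\<Prod>ij\<in>{..<n} \<times> {..<n}. (pr n P $$ ij) ^ m ij))"
    unfolding polynomial_function_def by auto
  show "block_poly n f" unfolding f
  proof (intro block_poly_sum block_poly.mult block_poly.const block_poly_prod block_poly_power)
    fix ij assume ij: "ij \<in> {..<n} \<times> {..<n}"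
    obtain i j where "ij = (i, j)" by (cases ij)
    then have "pr n P $$ ij = P i j" for P :: "'k inf_mat"
      using ij by (auto simp: pr_def)
    moreover have "block_poly n (\<lambda>P :: 'k inf_mat. P i j)"
      using ij \<open>ij = (i, j)\<close> by (auto intro: block_poly.entry)
    ultimately show "block_poly n (\<lambda>P :: 'k inf_mat. pr n P $$ ij)" by simp
  qed
qed

text \<open>The coordinate ring of the inverse limit, as a ring of functions: the union of the
  coordinate rings of all blocks.\<close>

definition entry_poly :: "('k::field inf_mat \<Rightarrow> 'k) \<Rightarrow> bool" where
  "entry_poly f \<longleftrightarrow> (\<exists>n. block_poly n f)"

lemma entry_poly_const: "entry_poly (\<lambda>P. c)"
  unfolding entry_poly_def by (blast intro: block_poly.const)

lemma entry_poly_entry: "entry_poly (\<lambda>P. P i j)"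
  unfolding entry_poly_def by (intro exI[of _ "Suc (max i j)"] block_poly.entry) auto

lemma entry_poly_add: "entry_poly f \<Longrightarrow> entry_poly g \<Longrightarrow> entry_poly (\<lambda>P. f P + g P)"
proof -
  assume "entry_poly f" "entry_poly g"
  then obtain n m where "block_poly n f" "block_poly m g" unfolding entry_poly_def by blast
  then have "block_poly (max n m) f" "block_poly (max n m) g" by (auto elim: block_poly_mono)
  then show ?thesis unfolding entry_poly_def by (blast intro: block_poly.add)
qed

lemma entry_poly_mult: "entry_poly f \<Longrightarrow> entry_poly g \<Longrightarrow> entry_poly (\<lambda>P. f P * g P)"
proof -
  assume "entry_poly f" "entry_poly g"
  then obtain n m where "block_poly n f" "block_poly m g" unfolding entry_poly_def by blast
  then have "block_poly (max n m) f" "block_poly (max n m) g" by (auto elim: block_poly_mono)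
  then show ?thesis unfolding entry_poly_def by (blast intro: block_poly.mult)
qed

lemma entry_poly_diff: "entry_poly f \<Longrightarrow> entry_poly g \<Longrightarrow> entry_poly (\<lambda>P. f P - g P)"
  using entry_poly_add[of f "\<lambda>P. (-1) * g P"] entry_poly_mult[of "\<lambda>P. -1" g] by (simp add: entry_poly_const)

lemma entry_poly_sum: "(\<And>i. i \<in> I \<Longrightarrow> entry_poly (f i)) \<Longrightarrow> entry_poly (\<lambda>P. \<Sum>i\<in>I. f i P)"
  by (induction I rule: infinite_finite_induct) (auto intro: entry_poly_const entry_poly_add)

lemma entry_poly_prod: "(\<And>i. i \<in> I \<Longrightarrow> entry_poly (f i)) \<Longrightarrow> entry_poly (\<lambda>P. \<Prod>i\<in>I. f i P)"
  by (induction I rule: infinite_finite_induct) (auto intro: entry_poly_const entry_poly_mult)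

lemma entry_poly_dot: "(\<And>k. entry_poly (\<lambda>P. x P k)) \<Longrightarrow> entry_poly (\<lambda>P. dot f (x P))"
  unfolding dot_def by (intro entry_poly_sum entry_poly_mult entry_poly_const)

lemma entry_poly_det:
  assumes "\<And>i j. entry_poly (\<lambda>P. a P i j)"
  shows "entry_poly (\<lambda>P. det (mat m m (\<lambda>(i, j). a P i j)))"
proof -
  have "det (mat m m (\<lambda>(i, j). a P i j)) =
    (\<Sum>p | p permutes {0..<m}. signof p * (\<Prod>i = 0..<m. a P i (p i)))" for P
  proof -
    have "det (mat m m (\<lambda>(i, j). a P i j)) = (\<Sum>p | p permutes {0..<m}. signof p *
        (\<Prod>i = 0..<m. mat m m (\<lambda>(i, j). a P i j) $$ (i, p i)))"
      by (rule det_def') simp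
    also have "\<dots> = (\<Sum>p | p permutes {0..<m}. signof p * (\<Prod>i = 0..<m. a P i (p i)))"
      by (intro sum.cong refl arg_cong2[where f = "(*)"] prod.cong)
         (auto simp: permutes_in_image dest: permutes_in_image[THEN iffD2])
    finally show ?thesis .
  qed
  then show ?thesis by (simp add: entry_poly_sum entry_poly_mult entry_poly_const entry_poly_prod assms)
qed

text \<open>\<open>Y n\<close> is the Zariski closure of the projection of \<open>X\<close> to the
  \<open>n\<close>-block. These closures are compatible because an equation on the small block is
  also an equation on the larger one.\<close>

lemma zariski_closed_top_left:
  fixes X :: "'k::field inf_mat set"
  defines "Y \<equiv> \<lambda>n. {A \<in> carrier_mat n n. \<forall>h. polynomial_function n h \<longrightarrow> (\<forall>P\<in>X. h (pr n P) = 0) \<longrightarrow> h A = 0}"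
  shows "zariski_closed n (Y n)" "top_left n ` Y (Suc n) \<subseteq> Y n"
proof -
  show "zariski_closed n (Y n)" unfolding zariski_closed_def Y_def
    by (intro exI[of _ "{h. polynomial_function n h \<and> (\<forall>P\<in>X. h (pr n P) = 0)}"]) auto
  show "top_left n ` Y (Suc n) \<subseteq> Y n"
  proof (rule image_subsetI)
    fix A assume A: "A \<in> Y (Suc n)"
    define Q where "Q i j = A $$ (i, j)" for i j
    have QA: "pr (Suc n) Q = A" "top_left n A = pr n Q"
      using A by (auto simp: Y_def Q_def pr_def top_left_def)
    have "h (pr n Q) = 0" if h: "polynomial_function n h" "\<forall>P\<in>X. h (pr n P) = 0" for h
    proof -
      have "block_poly n (\<lambda>P. h (pr n P))" using h(1) block_poly_iff by blast
      then have "block_poly (Suc n) (\<lambda>P. h (pr n P))" by (rule block_poly_mono) simp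
      then obtain h' where h': "polynomial_function (Suc n) h'" "(\<lambda>P. h (pr n P)) = (\<lambda>P. h' (pr (Suc n) P))"
        using block_poly_iff by blast
      then have eq: "h (pr n P) = h' (pr (Suc n) P)" for P by meson
      have "h' A = 0" using A h(2) h'(1) by (auto simp: Y_def eq)
      then show ?thesis by (simp add: eq QA)
    qed
    then show "top_left n A \<in> Y n" unfolding QA(2) by (auto simp: Y_def pr_def)
  qed
qed

text \<open>Replaces inverse systems by equations. In the way back the system consists of the
  Zariski closures of the projections of \<open>X\<close>; their limit is no larger than
  \<open>X\<close>, since each equation involves a single block and so holds on the closure at that
  level.\<close>

lemma closed_inf_iff:
  "closed_inf X \<longleftrightarrow> (\<exists>S. (\<forall>f\<in>S. entry_poly f) \<and> X = {P. \<forall>f\<in>S. f P = 0})"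
proof
  assume "closed_inf X"
  then obtain Y where Y: "\<And>n. n \<ge> 1 \<Longrightarrow> zariski_closed n (Y n)" "X = {P. \<forall>n\<ge>1. pr n P \<in> Y n}"
    unfolding closed_inf_def by blast
  have "\<forall>n. \<exists>S. n \<ge> 1 \<longrightarrow> (\<forall>f\<in>S. polynomial_function n f) \<and>
      Y n = {A \<in> carrier_mat n n. \<forall>f\<in>S. f A = 0}"
    using Y(1) unfolding zariski_closed_def by blast
  from choice[OF this] obtain S where
    S0: "\<forall>n. n \<ge> 1 \<longrightarrow> (\<forall>f\<in>S n. polynomial_function n f) \<and>
      Y n = {A \<in> carrier_mat n n. \<forall>f\<in>S n. f A = 0}" ..
  have S: "polynomial_function n f" if "n \<ge> 1" "f \<in> S n" for n f
    using S0 that by simp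
  have S': "Y n = {A \<in> carrier_mat n n. \<forall>f\<in>S n. f A = 0}" if "n \<ge> 1" for n
    using S0 that by simp
  define T where "T = (\<Union>n\<in>{1..}. (\<lambda>h P. h (pr n P)) ` S n)"
  have "entry_poly f" if f: "f \<in> T" for f
  proof -
    obtain n where n: "n \<in> {1..}" "f \<in> (\<lambda>h P. h (pr n P)) ` S n"
      using f unfolding T_def by (rule UN_E)
    from n(2) obtain h where h: "f = (\<lambda>P. h (pr n P))" "h \<in> S n" by (rule imageE)
    have "block_poly n f" unfolding block_poly_iff using h n(1) S by (intro exI[of _ h]) simp
    then show ?thesis unfolding entry_poly_def by blast
  qed
  moreover have "X = {P. \<forall>f\<in>T. f P = 0}"
  proof -
    have "pr n P \<in> Y n \<longleftrightarrow> (\<forall>h\<in>S n. h (pr n P) = 0)" if "n \<ge> 1" for n P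
      unfolding S'[OF that] by (simp add: pr_def)
    moreover have "(\<forall>f\<in>T. f P = 0) \<longleftrightarrow> (\<forall>n\<ge>1. \<forall>h\<in>S n. h (pr n P) = 0)" for P
      unfolding T_def by (simp add: atLeast_def)
    ultimately show ?thesis unfolding Y(2) by simp
  qed
  ultimately show "\<exists>S. (\<forall>f\<in>S. entry_poly f) \<and> X = {P. \<forall>f\<in>S. f P = 0}" by blast
next
  assume "\<exists>S. (\<forall>f\<in>S. entry_poly f) \<and> X = {P. \<forall>f\<in>S. f P = 0}"
  then obtain S where S: "\<And>f. f \<in> S \<Longrightarrow> entry_poly f" "X = {P. \<forall>f\<in>S. f P = 0}" by blast
  define Y where "Y n = {A \<in> carrier_mat n n. \<forall>h. polynomial_function n h \<longrightarrow> (\<forall>P\<in>X. h (pr n P) = 0) \<longrightarrow> h A = 0}" for n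
  have "X = {P. \<forall>n\<ge>1. pr n P \<in> Y n}"
  proof (intro equalityI subsetI CollectI)
    fix P assume "P \<in> {P. \<forall>n\<ge>1. pr n P \<in> Y n}"
    then have P: "pr n P \<in> Y n" if "n \<ge> 1" for n using that by blast
    have "f P = 0" if f: "f \<in> S" for f
    proof -
      obtain n where "block_poly n f" using S(1)[OF f] entry_poly_def by blast
      \<comment> \<open>The system starts at level 1, while \<open>n\<close> may be 0.\<close>
      then have "block_poly (Suc n) f" by (rule block_poly_mono) simp
      then obtain h where h: "polynomial_function (Suc n) h" "f = (\<lambda>P. h (pr (Suc n) P))"
        using block_poly_iff by blast
      then have "\<forall>P\<in>X. h (pr (Suc n) P) = 0" using f S(2) by auto
      then show ?thesis using P[of "Suc n"] h by (auto simp: Y_def)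
    qed
    then show "P \<in> X" using S(2) by blast
  qed (auto simp: Y_def pr_def)
  then show "closed_inf X" unfolding closed_inf_def
    using zariski_closed_top_left[of _ X] by (intro exI[of _ Y]) (auto simp: Y_def)
qed

text \<open>Membership is tested on one block at a time, so the witness in \<open>X\<close> may vary
  with \<open>n\<close>. All orbit closures are reached this way.\<close>

lemma closed_inf_limit:
  assumes "closed_inf X" "\<And>n. \<exists>P\<in>X. \<forall>i<n. \<forall>j<n. P i j = Q i j"
  shows "Q \<in> X"
proof -
  obtain Y where Y: "X = {P. \<forall>n\<ge>1. pr n P \<in> Y n}"
    using assms(1) unfolding closed_inf_def by blast
  have "pr n Q \<in> Y n" if "n \<ge> 1" for n
  proof -
    obtain P where P: "P \<in> X" "\<forall>i<n. \<forall>j<n. P i j = Q i j" using assms(2) by blast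
    then have "pr n P = pr n Q" by (auto simp: pr_def)
    then show ?thesis using P(1) that Y by auto
  qed
  then show ?thesis using Y by blast
qed

lemma closed_inf_UNIV: "closed_inf UNIV"
  unfolding closed_inf_iff by (intro exI[of _ "{}"]) auto

lemma closed_inf_empty: "closed_inf {}"
  unfolding closed_inf_iff by (intro exI[of _ "{\<lambda>P. 1}"]) (auto intro: entry_poly_const)

lemma closed_inf_Un:
  assumes "closed_inf X" "closed_inf Y" shows "closed_inf (X \<union> Y)"
proof -
  obtain S T where S: "\<forall>f\<in>S. entry_poly f" "X = {P. \<forall>f\<in>S. f P = 0}"
    and T: "\<forall>f\<in>T. entry_poly f" "Y = {P. \<forall>f\<in>T. f P = 0}"
    using assms unfolding closed_inf_iff by blast
  define R where "R = {\<lambda>P. f P * g P | f g. f \<in> S \<and> g \<in> T}"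
  have R: "f P * g P = 0" if "\<forall>h\<in>R. h P = 0" "f \<in> S" "g \<in> T" for f g P
  proof -
    have "(\<lambda>P. f P * g P) \<in> R" unfolding R_def using that(2,3) by blast
    from that(1)[rule_format, OF this] show ?thesis .
  qed
  have "X \<union> Y = {P. \<forall>h\<in>R. h P = 0}"
  proof
    show "X \<union> Y \<subseteq> {P. \<forall>h\<in>R. h P = 0}" unfolding S(2) T(2) R_def by auto
    show "{P. \<forall>h\<in>R. h P = 0} \<subseteq> X \<union> Y"
    proof (intro subsetI)
      fix P assume "P \<in> {P. \<forall>h\<in>R. h P = 0}"
      then have "f P = 0 \<or> g P = 0" if "f \<in> S" "g \<in> T" for f g
        using R[of P f g] that by simp
      then show "P \<in> X \<union> Y" unfolding S(2) T(2) by blast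
    qed
  qed
  moreover have "\<forall>h\<in>R. entry_poly h" using S(1) T(1) unfolding R_def by (auto intro: entry_poly_mult)
  ultimately show ?thesis unfolding closed_inf_iff by blast
qed

lemma closed_inf_Union: "finite F \<Longrightarrow> (\<And>X. X \<in> F \<Longrightarrow> closed_inf X) \<Longrightarrow> closed_inf (\<Union>F)"
  by (induction F rule: finite_induct) (auto intro: closed_inf_empty closed_inf_Un)

text \<open>For fixed functionals the determinant is a polynomial in the entries, and a closed set
  may have infinitely many equations, so one equation is imposed for every \<open>u\<close> and
  every choice of functionals.\<close>

lemma closed_inf_not_indep:
  fixes y :: "'k::field inf_mat \<Rightarrow> 'u \<Rightarrow> nat \<Rightarrow> nat \<Rightarrow> 'k"
  assumes "\<And>u j k. u \<in> U \<Longrightarrow> entry_poly (\<lambda>P. y P u j k)"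
  shows "closed_inf {P. \<forall>u\<in>U. \<not> indep m (y P u)}"
proof -
  define S where "S = (\<Union>u\<in>U. (\<lambda>f P. det (mat m m (\<lambda>(i, j). dot (f i) (y P u j)))) ` {f. \<forall>i<m. finsup (f i)})"
  have "\<forall>f\<in>S. entry_poly f" unfolding S_def by (auto intro!: entry_poly_det entry_poly_dot assms)
  moreover have "{P. \<forall>u\<in>U. \<not> indep m (y P u)} = {P. \<forall>f\<in>S. f P = 0}"
    unfolding indep_iff_det S_def by auto
  ultimately show ?thesis unfolding closed_inf_iff by blast
qed

lemma closed_inf_rank: "closed_inf {P. rank_le k (shift P c)}"
proof -
  have "closed_inf {P. \<forall>\<sigma>\<in>UNIV. \<not> indep (Suc k) (\<lambda>l. app (shift P c) (id_inf (\<sigma> l)))}"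
    by (intro closed_inf_not_indep) (simp add: app_unit shift_def entry_poly_diff entry_poly_const entry_poly_entry)
  then show ?thesis by (simp add: rank_le_iff_indep)
qed

lemma closed_inf_rank_tuple: "closed_inf {P :: 'k::field inf_mat. \<exists>c. rank_le k (shift P c)}"
proof -
  have "closed_inf {P :: 'k inf_mat. \<forall>u\<in>{u. \<forall>i<Suc k. finsup (u i)}. \<not> indep (2 * Suc k) (pairs P u)}"
  proof (rule closed_inf_not_indep)
    fix u :: "nat \<Rightarrow> nat \<Rightarrow> 'k" and j l
    show "entry_poly (\<lambda>P. pairs P u j l)"
      by (cases "even j") (simp_all add: pairs_def app_def entry_poly_const entry_poly_dot entry_poly_entry)
  qed
  moreover have "{P :: 'k inf_mat. \<forall>u\<in>{u. \<forall>i<Suc k. finsup (u i)}. \<not> indep (2 * Suc k) (pairs P u)} =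
      {P. \<exists>c. rank_le k (shift P c)}"
    unfolding scalar_plus_rank_le_iff by auto
  ultimately show ?thesis by (rule back_subst)
qed

section \<open>Polynomial curves and irreducibility\<close>

definition line_poly :: "('k::field \<Rightarrow> 'k) \<Rightarrow> bool" where
  "line_poly g \<longleftrightarrow> (\<exists>p. \<forall>t. g t = poly p t)"

lemma line_poly_const: "line_poly (\<lambda>t. c)"
  unfolding line_poly_def by (intro exI[of _ "[:c:]"]) simp

lemma line_poly_affine: "line_poly (\<lambda>t. a + t * b)"
  unfolding line_poly_def by (intro exI[of _ "[:a, b:]"]) simp

lemma line_poly_add: "line_poly f \<Longrightarrow> line_poly g \<Longrightarrow> line_poly (\<lambda>t. f t + g t)"
  unfolding line_poly_def by (metis poly_add)

lemma line_poly_mult: "line_poly f \<Longrightarrow> line_poly g \<Longrightarrow> line_poly (\<lambda>t. f t * g t)"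
  unfolding line_poly_def by (metis poly_mult)

lemma line_poly_sum: "(\<And>i. i \<in> I \<Longrightarrow> line_poly (f i)) \<Longrightarrow> line_poly (\<lambda>t. \<Sum>i\<in>I. f i t)"
  by (induction I rule: infinite_finite_induct) (auto intro: line_poly_const line_poly_add)

lemma line_poly_curve:
  assumes "entry_poly f" "\<And>i j. line_poly (\<lambda>t. \<gamma> t i j)" shows "line_poly (\<lambda>t. f (\<gamma> t))"
proof -
  obtain n where "block_poly n f" using assms(1) entry_poly_def by blast
  then show ?thesis
    by (induction rule: block_poly.induct) (auto intro: line_poly_const line_poly_add line_poly_mult assms(2))
qed

text \<open>An equation of \<open>X\<close> that fails at one point of the curve pulls back to a
  nonzero polynomial in \<open>t\<close>, which has finitely many roots. This serves both for
  irreducibility and for the sets of scalars that determine a stable closed set.\<close>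

lemma closed_inf_curve:
  assumes "closed_inf X" "\<And>i j. line_poly (\<lambda>t. \<gamma> t i j)"
  shows "{t. \<gamma> t \<in> X} = UNIV \<or> finite {t. \<gamma> t \<in> X}"
proof (cases "{t. \<gamma> t \<in> X} = UNIV")
  case False
  then obtain t0 where "\<gamma> t0 \<notin> X" by blast
  moreover obtain S where S: "\<forall>f\<in>S. entry_poly f" "X = {P. \<forall>f\<in>S. f P = 0}"
    using assms(1) unfolding closed_inf_iff by blast
  ultimately obtain f where f: "f \<in> S" "f (\<gamma> t0) \<noteq> 0" by blast
  obtain p where p: "\<And>t. f (\<gamma> t) = poly p t"
    using line_poly_curve[of f \<gamma>] f(1) S(1) assms(2) unfolding line_poly_def by blast
  have "p \<noteq> 0" using f(2) p by auto
  moreover have "{t. \<gamma> t \<in> X} \<subseteq> {t. poly p t = 0}" using f(1) S(2) p by auto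
  ultimately have "finite {t. \<gamma> t \<in> X}" using poly_roots_finite finite_subset by blast
  then show ?thesis by blast
qed simp

text \<open>A curve from a point outside \<open>Y\<close> to a point outside \<open>Z\<close> meets
  each of them for finitely many parameters only, and two finite sets do not cover an infinite
  line.\<close>

lemma irreducible_inf_curves:
  fixes X :: "'k::field inf_mat set"
  assumes "infinite (UNIV :: 'k set)" "closed_inf X" "X \<noteq> {}"
    and curve: "\<And>P Q. P \<in> X \<Longrightarrow> Q \<in> X \<Longrightarrow>
      \<exists>\<gamma>. (\<forall>i j. line_poly (\<lambda>t. \<gamma> t i j)) \<and> \<gamma> 0 = P \<and> \<gamma> 1 = Q \<and> (\<forall>t. \<gamma> t \<in> X)"
  shows "irreducible_inf X"
  unfolding irreducible_inf_def
proof (intro conjI allI impI assms(2,3))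
  fix Y Z assume YZ: "closed_inf Y \<and> closed_inf Z \<and> Y \<subseteq> X \<and> Z \<subseteq> X \<and> X = Y \<union> Z"
  show "X = Y \<or> X = Z"
  proof (rule ccontr)
    assume "\<not> ?thesis"
    then obtain P Q where PQ: "P \<in> X" "P \<notin> Y" "Q \<in> X" "Q \<notin> Z" using YZ by blast
    obtain \<gamma> where \<gamma>: "\<And>i j. line_poly (\<lambda>t. \<gamma> t i j)" "\<gamma> 0 = P" "\<gamma> 1 = Q" "\<And>t. \<gamma> t \<in> X"
      using curve[OF PQ(1,3)] by blast
    have "0 \<notin> {t. \<gamma> t \<in> Y}" "1 \<notin> {t. \<gamma> t \<in> Z}" using PQ \<gamma>(2,3) by auto
    then have "finite {t. \<gamma> t \<in> Y}" "finite {t. \<gamma> t \<in> Z}"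
      using closed_inf_curve[of Y \<gamma>] closed_inf_curve[of Z \<gamma>] YZ \<gamma>(1) by blast+
    moreover have "UNIV = {t. \<gamma> t \<in> Y} \<union> {t. \<gamma> t \<in> Z}" using \<gamma>(4) YZ by blast
    ultimately show False using assms(1) by (metis finite_Un)
  qed
qed

text \<open>The factors of the outer products are interpolated instead of the matrices, whose
  straight segment could pass through rank \<open>2 * k\<close>. The scalar moves linearly from
  \<open>c\<close> to \<open>d\<close> and stays fixed when \<open>c = d\<close>.\<close>

lemma rank_curve:
  assumes "rank_le k (shift P c)" "rank_le k (shift Q d)"
  shows "\<exists>\<gamma>. (\<forall>i j. line_poly (\<lambda>t. \<gamma> t i j)) \<and> \<gamma> 0 = P \<and> \<gamma> 1 = Q \<and>
    (\<forall>t. rank_le k (shift (\<gamma> t) (c + t * (d - c))))"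
proof -
  obtain a b where P: "\<And>i j. P i j - c * id_inf i j = (\<Sum>l<k. a l i * b l j)"
    using assms(1) unfolding rank_le_def shift_def by blast
  obtain a' b' where Q: "\<And>i j. Q i j - d * id_inf i j = (\<Sum>l<k. a' l i * b' l j)"
    using assms(2) unfolding rank_le_def shift_def by blast
  define \<gamma> where "\<gamma> t i j = (c + t * (d - c)) * id_inf i j +
    (\<Sum>l<k. (a l i + t * (a' l i - a l i)) * (b l j + t * (b' l j - b l j)))" for t i j
  have "line_poly (\<lambda>t. \<gamma> t i j)" for i j
    unfolding \<gamma>_def by (intro line_poly_add line_poly_mult line_poly_affine line_poly_const line_poly_sum)
  moreover have "\<gamma> 0 = P" "\<gamma> 1 = Q"
    by (intro ext; simp add: \<gamma>_def P[symmetric] Q[symmetric])+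
  moreover have "rank_le k (shift (\<gamma> t) (c + t * (d - c)))" for t
    unfolding rank_le_def shift_def \<gamma>_def
    by (intro exI[of _ "\<lambda>l i. a l i + t * (a' l i - a l i)"] exI[of _ "\<lambda>l j. b l j + t * (b' l j - b l j)"]) simp
  ultimately show ?thesis by blast
qed

lemma scalar_rank_le: "rank_le k (shift (\<lambda>i j. c * id_inf i j) c)"
  unfolding rank_le_def shift_def by (intro exI[of _ "\<lambda>_ _. 0"]) simp

lemma irreducible_inf_rank:
  assumes "infinite (UNIV :: 'k::field set)"
  shows "irreducible_inf {P :: 'k inf_mat. rank_le k (shift P c)}"
proof (rule irreducible_inf_curves[OF assms closed_inf_rank])
  show "{P :: 'k inf_mat. rank_le k (shift P c)} \<noteq> {}" using scalar_rank_le by blast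
  fix P Q :: "'k inf_mat"
  assume "P \<in> {P. rank_le k (shift P c)}" "Q \<in> {P. rank_le k (shift P c)}"
  then show "\<exists>\<gamma>. (\<forall>i j. line_poly (\<lambda>t. \<gamma> t i j)) \<and> \<gamma> 0 = P \<and> \<gamma> 1 = Q \<and>
      (\<forall>t. \<gamma> t \<in> {P. rank_le k (shift P c)})"
    using rank_curve[of k P c Q c] by simp
qed

lemma irreducible_inf_rank_tuple:
  assumes "infinite (UNIV :: 'k::field set)"
  shows "irreducible_inf {P :: 'k inf_mat. \<exists>c. rank_le k (shift P c)}"
proof (rule irreducible_inf_curves[OF assms closed_inf_rank_tuple])
  show "{P :: 'k inf_mat. \<exists>c. rank_le k (shift P c)} \<noteq> {}" using scalar_rank_le by blast
  fix P Q :: "'k inf_mat"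
  assume "P \<in> {P. \<exists>c. rank_le k (shift P c)}" "Q \<in> {P. \<exists>c. rank_le k (shift P c)}"
  then obtain c d where "rank_le k (shift P c)" "rank_le k (shift Q d)" by blast
  from rank_curve[OF this] show "\<exists>\<gamma>. (\<forall>i j. line_poly (\<lambda>t. \<gamma> t i j)) \<and> \<gamma> 0 = P \<and> \<gamma> 1 = Q \<and>
      (\<forall>t. \<gamma> t \<in> {P. \<exists>c. rank_le k (shift P c)})"
    by blast
qed

lemma irreducible_inf_UNIV:
  assumes "infinite (UNIV :: 'k::field set)"
  shows "irreducible_inf (UNIV :: 'k inf_mat set)"
proof (rule irreducible_inf_curves[OF assms closed_inf_UNIV])
  fix P Q :: "'k inf_mat"
  show "\<exists>\<gamma>. (\<forall>i j. line_poly (\<lambda>t. \<gamma> t i j)) \<and> \<gamma> 0 = P \<and> \<gamma> 1 = Q \<and> (\<forall>t. \<gamma> t \<in> UNIV)"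
    by (intro exI[of _ "\<lambda>t i j. P i j + t * (Q i j - P i j)"]) (simp add: line_poly_affine)
qed simp

lemma irreducible_inf_Union:
  assumes "finite F" "irreducible_inf X" "X = \<Union>F" "\<And>Y. Y \<in> F \<Longrightarrow> closed_inf Y"
  shows "X \<in> F"
  using assms
proof (induction F rule: finite_induct)
  case empty
  then show ?case by (simp add: irreducible_inf_def)
next
  case (insert Y F)
  then have "X = Y \<or> X = \<Union>F"
    using closed_inf_Union[of F] unfolding irreducible_inf_def by auto
  then show ?case using insert by auto
qed

section \<open>Conjugation by the special linear group\<close>

lemma mult_inf_eq_sum:
  assumes "\<And>k. k \<ge> N \<Longrightarrow> P i k * Q k j = 0"
  shows "mult_inf P Q i j = (\<Sum>k<N. P i k * Q k j)"
  unfolding mult_inf_def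
  by (rule Sum_any.expand_superset) (use assms in \<open>auto simp: not_less[symmetric]\<close>)

lemma mult_inf_left: assumes "finsup (P i)" shows "mult_inf P Q i j = dot (P i) (\<lambda>k. Q k j)"
proof -
  obtain N where N: "\<And>k. k \<ge> N \<Longrightarrow> P i k = 0" using assms unfolding finsup_def by blast
  then show ?thesis using mult_inf_eq_sum[of N P i Q j] dot_eq[of N "P i"] by simp
qed

lemma mult_inf_right:
  assumes "finsup (\<lambda>k. Q k j)" shows "mult_inf P Q i j = dot (\<lambda>k. Q k j) (P i)"
proof -
  obtain N where N: "\<And>k. k \<ge> N \<Longrightarrow> Q k j = 0" using assms unfolding finsup_def by blast
  then show ?thesis using mult_inf_eq_sum[of N P i Q j] dot_eq[of N "\<lambda>k. Q k j"]
    by (simp add: mult.commute)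
qed

lemma dot_app:
  assumes "finsup f" shows "dot v (\<lambda>k. dot f (\<lambda>l. P l k)) = dot f (app P v)"
proof -
  obtain N where N: "\<And>k. k \<ge> N \<Longrightarrow> f k = 0" using assms unfolding finsup_def by blast
  have "dot v (\<lambda>k. dot f (\<lambda>l. P l k)) = dot v (\<lambda>k. \<Sum>l<N. f l * P l k)"
    by (simp add: dot_eq[OF N])
  also have "\<dots> = (\<Sum>l<N. f l * dot v (P l))" by (rule dot_sum_right)
  also have "\<dots> = dot f (app P v)" by (simp add: dot_eq[OF N] app_def)
  finally show ?thesis .
qed

lemma diag_inf_eq:
  "A \<in> carrier_mat n n \<Longrightarrow> diag_inf A i j = (if i < n \<and> j < n then A $$ (i, j) else id_inf i j)"
  by (auto simp: diag_inf_def)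

lemma finsup_diag_inf:
  assumes "A \<in> carrier_mat n n"
  shows "finsup (diag_inf A i)" "finsup (\<lambda>k. diag_inf A k j)"
  unfolding finsup_def
  by (rule exI[of _ "max n (Suc i)"], use assms in \<open>auto simp: diag_inf_eq id_inf_def\<close>)
     (rule exI[of _ "max n (Suc j)"], use assms in \<open>auto simp: diag_inf_eq id_inf_def\<close>)

lemma mult_diag_inf:
  assumes A: "A \<in> carrier_mat n n" and B: "B \<in> carrier_mat n n"
  shows "mult_inf (diag_inf A) (diag_inf B) = diag_inf (A * B)"
proof (intro ext)
  fix i j
  have AB: "A * B \<in> carrier_mat n n" using A B by simp
  show "mult_inf (diag_inf A) (diag_inf B) i j = diag_inf (A * B) i j"
  proof (cases "i < n")
    case True
    then have "mult_inf (diag_inf A) (diag_inf B) i j = (\<Sum>k<n. diag_inf A i k * diag_inf B k j)"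
      by (intro mult_inf_eq_sum) (auto simp: diag_inf_eq[OF A] id_inf_def)
    also have "\<dots> = (\<Sum>k<n. A $$ (i, k) * (if j < n then B $$ (k, j) else 0))"
      using True by (intro sum.cong) (auto simp: diag_inf_eq[OF A] diag_inf_eq[OF B] id_inf_def)
    also have "\<dots> = diag_inf (A * B) i j"
      using True A B by (auto simp: diag_inf_eq[OF AB] scalar_prod_def atLeast0LessThan id_inf_def)
    finally show ?thesis .
  next
    case False
    then have row: "diag_inf A i = id_inf i" by (auto simp: diag_inf_eq[OF A])
    have "mult_inf (diag_inf A) (diag_inf B) i j = dot (id_inf i) (\<lambda>k. diag_inf B k j)"
      using mult_inf_left[of "diag_inf A" i "diag_inf B" j] by (simp add: row)
    also have "\<dots> = diag_inf (A * B) i j"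
      using False by (simp add: diag_inf_eq[OF AB] diag_inf_eq[OF B])
    finally show ?thesis .
  qed
qed

lemma diag_inf_one: "diag_inf (1\<^sub>m n) = id_inf"
  by (auto simp: fun_eq_iff diag_inf_eq[of _ n] id_inf_def)

text \<open>Elements of the direct limit come from matrices of different sizes; padding brings them
  to a common size, where they can be multiplied.\<close>

lemma diag_inf_pad:
  assumes "A \<in> carrier_mat n n" "n \<le> N"
  shows "\<exists>A'\<in>carrier_mat N N. det A' = det A \<and> diag_inf A' = diag_inf A"
proof (intro bexI conjI)
  let ?A = "four_block_mat A (0\<^sub>m n (N - n)) (0\<^sub>m (N - n) n) (1\<^sub>m (N - n))"
  show c: "?A \<in> carrier_mat N N" using assms by auto
  show "det ?A = det A"
    using assms(1) by (subst det_four_block_mat_lower_left_zero[of _ n _ "N - n"]) auto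
  show "diag_inf ?A = diag_inf A"
    using assms by (auto simp: fun_eq_iff diag_inf_eq[OF c] diag_inf_eq[OF assms(1)] id_inf_def)
qed

lemma carrier_SL_inf:
  "g \<in> carrier SL_inf \<longleftrightarrow> (\<exists>n\<ge>1. \<exists>A\<in>carrier_mat n n. det A = 1 \<and> g = diag_inf A)"
  by (auto simp: SL_inf_def)

lemma carrier_SL_inf_large:
  assumes "g \<in> carrier SL_inf"
  obtains n where "\<And>N. N \<ge> n \<Longrightarrow> \<exists>A\<in>carrier_mat N N. det A = 1 \<and> g = diag_inf A"
proof -
  obtain n A where "A \<in> carrier_mat n n" "det A = 1" "g = diag_inf A"
    using assms unfolding carrier_SL_inf by blast
  then show ?thesis using that[of n] diag_inf_pad[of A n] by metis
qed

text \<open>Stability refers to the group inverse, a definite description that can be evaluated once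
  the group laws are known. For determinant 1 the inverse matrix is the adjugate.\<close>

lemma group_SL_inf: "group (SL_inf :: 'k::field inf_mat monoid)"
proof (rule groupI)
  have mult: "x \<otimes>\<^bsub>SL_inf\<^esub> y = mult_inf x y" for x y :: "'k inf_mat"
    by (simp add: SL_inf_def)
  have one: "\<one>\<^bsub>SL_inf\<^esub> = (id_inf :: 'k inf_mat)" by (simp add: SL_inf_def)
  show "\<one>\<^bsub>SL_inf\<^esub> \<in> carrier (SL_inf :: 'k inf_mat monoid)"
    unfolding one carrier_SL_inf
    by (intro exI[of _ 1] conjI bexI[of _ "1\<^sub>m 1"]) (auto simp: diag_inf_one)
  fix x y z :: "'k inf_mat" assume x: "x \<in> carrier SL_inf"
  obtain n A where A: "n \<ge> 1" "A \<in> carrier_mat n n" "det A = 1" "x = diag_inf A"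
    using x unfolding carrier_SL_inf by blast
  show "\<one>\<^bsub>SL_inf\<^esub> \<otimes>\<^bsub>SL_inf\<^esub> x = x"
    using mult_diag_inf[of "1\<^sub>m n" n A] A(2) by (simp add: mult one A(4) diag_inf_one)
  show "\<exists>y\<in>carrier SL_inf. y \<otimes>\<^bsub>SL_inf\<^esub> x = \<one>\<^bsub>SL_inf\<^esub>"
  proof
    note adj = adj_mat[OF A(2)]
    have "det (adj_mat A * A) = 1" using adj(3) A(3) by simp
    then have "det (adj_mat A) = 1" using det_mult[OF adj(1) A(2)] A(3) by simp
    then show "diag_inf (adj_mat A) \<in> carrier SL_inf" using adj(1) A(1) unfolding carrier_SL_inf by blast
    show "diag_inf (adj_mat A) \<otimes>\<^bsub>SL_inf\<^esub> x = \<one>\<^bsub>SL_inf\<^esub>"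
    proof -
      have "adj_mat A * A = 1\<^sub>m n" using adj(3) A(3) by (auto simp: mat_eq_iff)
      then show ?thesis by (simp add: mult one A(4) mult_diag_inf[OF adj(1) A(2)] diag_inf_one)
    qed
  qed
  assume y: "y \<in> carrier SL_inf"
  obtain nx where nx: "\<And>N. N \<ge> nx \<Longrightarrow> \<exists>A\<in>carrier_mat N N. det A = 1 \<and> x = diag_inf A"
    using x by (rule carrier_SL_inf_large) blast
  obtain ny where ny: "\<And>N. N \<ge> ny \<Longrightarrow> \<exists>A\<in>carrier_mat N N. det A = 1 \<and> y = diag_inf A"
    using y by (rule carrier_SL_inf_large) blast
  show "x \<otimes>\<^bsub>SL_inf\<^esub> y \<in> carrier SL_inf"
  proof -
    define N where "N = Suc (max nx ny)"
    have N: "nx \<le> N" "ny \<le> N" by (simp_all add: N_def)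
    obtain A where A: "A \<in> carrier_mat N N" "det A = 1" "x = diag_inf A"
      using nx[OF N(1)] by blast
    obtain B where B: "B \<in> carrier_mat N N" "det B = 1" "y = diag_inf B"
      using ny[OF N(2)] by blast
    have "A * B \<in> carrier_mat N N" "det (A * B) = 1" using A B by (auto simp: det_mult[OF A(1) B(1)])
    moreover have "x \<otimes>\<^bsub>SL_inf\<^esub> y = diag_inf (A * B)"
      by (simp add: mult A(3) B(3) mult_diag_inf[OF A(1) B(1)])
    moreover have "1 \<le> N" by (simp add: N_def)
    ultimately show ?thesis unfolding carrier_SL_inf by blast
  qed
  assume z: "z \<in> carrier SL_inf"
  obtain nz where nz: "\<And>N. N \<ge> nz \<Longrightarrow> \<exists>A\<in>carrier_mat N N. det A = 1 \<and> z = diag_inf A"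
    using z by (rule carrier_SL_inf_large) blast
  define N where "N = max nx (max ny nz)"
  have N: "nx \<le> N" "ny \<le> N" "nz \<le> N" by (simp_all add: N_def)
  obtain A where A: "A \<in> carrier_mat N N" "x = diag_inf A"
    using nx[OF N(1)] by blast
  obtain B where B: "B \<in> carrier_mat N N" "y = diag_inf B"
    using ny[OF N(2)] by blast
  obtain C where C: "C \<in> carrier_mat N N" "z = diag_inf C"
    using nz[OF N(3)] by blast
  have AB: "A * B \<in> carrier_mat N N" and BC: "B * C \<in> carrier_mat N N" using A B C by auto
  show "x \<otimes>\<^bsub>SL_inf\<^esub> y \<otimes>\<^bsub>SL_inf\<^esub> z = x \<otimes>\<^bsub>SL_inf\<^esub> (y \<otimes>\<^bsub>SL_inf\<^esub> z)"
    using assoc_mult_mat[OF A(1) B(1) C(1)]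
    by (simp add: mult A(2) B(2) C(2) mult_diag_inf[OF A(1) B(1)] mult_diag_inf[OF B(1) C(1)]
        mult_diag_inf[OF AB C(1)] mult_diag_inf[OF A(1) BC])
qed

lemma inv_SL_inf:
  fixes A :: "'k::field mat"
  assumes n: "n \<ge> 1" and A: "A \<in> carrier_mat n n" and B: "B \<in> carrier_mat n n"
    and AB: "A * B = 1\<^sub>m n" and d: "det A = 1"
  shows "diag_inf A \<in> carrier SL_inf" "inv\<^bsub>SL_inf\<^esub> (diag_inf A) = diag_inf B"
proof -
  show c: "diag_inf A \<in> carrier SL_inf" using n A d unfolding carrier_SL_inf by blast
  have "det B = 1" using det_mult[OF A B] AB d by simp
  then have c': "diag_inf B \<in> carrier SL_inf" using n B unfolding carrier_SL_inf by blast
  have "B * A = 1\<^sub>m n" by (rule mat_mult_left_right_inverse[OF A B AB])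
  then have "diag_inf B \<otimes>\<^bsub>SL_inf\<^esub> diag_inf A = \<one>\<^bsub>SL_inf\<^esub>"
    using mult_diag_inf[OF B A] by (simp add: SL_inf_def diag_inf_one)
  then show "inv\<^bsub>SL_inf\<^esub> (diag_inf A) = diag_inf B"
    by (rule group.inv_equality[OF group_SL_inf _ c c'])
qed

definition conj_inf :: "'k::field inf_mat \<Rightarrow> 'k inf_mat \<Rightarrow> 'k inf_mat" where
  "conj_inf g P = mult_inf (mult_inf g P) (inv\<^bsub>SL_inf\<^esub> g)"

lemma SL_stable_iff: "SL_stable X \<longleftrightarrow> (\<forall>g\<in>carrier SL_inf. \<forall>P\<in>X. conj_inf g P \<in> X)"
  by (simp add: SL_stable_def conj_inf_def)

text \<open>Conjugation read as a pairing: row \<open>i\<close> of \<open>A\<close> against the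
  image under \<open>P\<close> of column \<open>j\<close> of the inverse. The rest of the argument
  uses only that these rows and columns are biorthogonal.\<close>

lemma conj_diag_inf:
  assumes "n \<ge> 1" "A \<in> carrier_mat n n" "B \<in> carrier_mat n n" "A * B = 1\<^sub>m n" "det A = 1"
  shows "conj_inf (diag_inf A) P i j = dot (diag_inf A i) (app P (\<lambda>k. diag_inf B k j))"
proof -
  have "conj_inf (diag_inf A) P i j = dot (\<lambda>k. diag_inf B k j) (mult_inf (diag_inf A) P i)"
    unfolding conj_inf_def inv_SL_inf(2)[OF assms]
    by (rule mult_inf_right) (rule finsup_diag_inf[OF assms(3)])
  also have "mult_inf (diag_inf A) P i = (\<lambda>k. dot (diag_inf A i) (\<lambda>l. P l k))"
    by (rule ext, rule mult_inf_left) (rule finsup_diag_inf[OF assms(2)])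
  also have "dot (\<lambda>k. diag_inf B k j) \<dots> = dot (diag_inf A i) (app P (\<lambda>k. diag_inf B k j))"
    by (rule dot_app) (rule finsup_diag_inf[OF assms(2)])
  finally show ?thesis .
qed

text \<open>Outer products go to outer products of the transported factors, and biorthogonality of
  the rows of \<open>A\<close> and the columns of its inverse preserves the scalar part.\<close>

lemma rank_le_conj:
  assumes g: "g \<in> carrier SL_inf" and P: "rank_le k (shift P c)"
  shows "rank_le k (shift (conj_inf g P) c)"
proof -
  obtain n A where A: "n \<ge> 1" "A \<in> carrier_mat n n" "det A = 1" "g = diag_inf A"
    using g unfolding carrier_SL_inf by blast
  define B where "B = adj_mat A"
  have B: "B \<in> carrier_mat n n" "A * B = 1\<^sub>m n"
    using adj_mat[OF A(2)] A(3) by (auto simp: B_def)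
  let ?h = "\<lambda>j k. diag_inf B k j"
  have fs: "finsup (diag_inf A i)" "finsup (?h j)" for i j
    by (rule finsup_diag_inf[OF A(2)], rule finsup_diag_inf[OF B(1)])
  have gh: "dot (diag_inf A i) (?h j) = id_inf i j" for i j
    using mult_inf_left[of "diag_inf A" i "diag_inf B" j, OF fs(1)] mult_diag_inf[OF A(2) B(1)]
    by (simp add: B(2) diag_inf_one)
  obtain a b where ab: "\<And>i j. shift P c i j = (\<Sum>l<k. a l i * b l j)"
    using P unfolding rank_le_def by blast
  have "shift (conj_inf g P) c i j = (\<Sum>l<k. dot (diag_inf A i) (a l) * dot (?h j) (b l))" for i j
  proof -
    have "app P (?h j) = (\<lambda>i. c * ?h j i + 1 * (\<Sum>l<k. dot (?h j) (b l) * a l i))"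
      using app_shift[of "?h j" P c, OF fs(2)] app_factorization[of "shift P c" a b k "?h j", OF ab]
      by (simp add: fun_eq_iff algebra_simps)
    then have "conj_inf g P i j = dot (diag_inf A i) (\<lambda>i. c * ?h j i + 1 * (\<Sum>l<k. dot (?h j) (b l) * a l i))"
      using conj_diag_inf[OF A(1,2) B A(3), of P i j] by (simp add: A(4))
    also have "\<dots> = c * id_inf i j + (\<Sum>l<k. dot (?h j) (b l) * dot (diag_inf A i) (a l))"
      unfolding dot_add_right dot_sum_right dot_mult_right gh by simp
    finally show ?thesis by (simp add: shift_def mult.commute)
  qed
  then show ?thesis unfolding rank_le_def
    by (intro exI[of _ "\<lambda>l i. dot (diag_inf A i) (a l)"] exI[of _ "\<lambda>l j. dot (?h j) (b l)"]) blast
qed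

section \<open>Biorthogonal systems and conjugates with a prescribed block\<close>

lemma biorthogonal_extend:
  fixes f v :: "nat \<Rightarrow> nat \<Rightarrow> 'k::field"
  assumes "m \<le> N" "\<And>i k. i < m \<Longrightarrow> k \<ge> N \<Longrightarrow> f i k = 0" "\<And>i k. i < m \<Longrightarrow> k \<ge> N \<Longrightarrow> v i k = 0"
    "\<And>i j. i < m \<Longrightarrow> j < m \<Longrightarrow> dot (f i) (v j) = id_inf i j"
  shows "\<exists>f' v'. (\<forall>i<m. f' i = f i \<and> v' i = v i) \<and>
    (\<forall>i<N. \<forall>k\<ge>N. f' i k = 0 \<and> v' i k = 0) \<and> (\<forall>i<N. \<forall>j<N. dot (f' i) (v' j) = id_inf i j)"
proof -
  have "\<exists>f' v'. (\<forall>i<m. f' i = f i \<and> v' i = v i) \<and>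
    (\<forall>i<n. \<forall>k\<ge>N. f' i k = 0 \<and> v' i k = 0) \<and> (\<forall>i<n. \<forall>j<n. dot (f' i) (v' j) = id_inf i j)"
    if "m \<le> n" "n \<le> N" for n
    using that
  proof (induction n rule: dec_induct)
    case base
    then show ?case using assms by (intro exI[of _ f] exI[of _ v]) auto
  next
    case (step n)
    then obtain f' v' where "\<forall>i<m. f' i = f i \<and> v' i = v i"
      "\<forall>i<n. \<forall>k\<ge>N. f' i k = 0 \<and> v' i k = 0" "\<forall>i<n. \<forall>j<n. dot (f' i) (v' j) = id_inf i j"
      by auto
    then have 1: "\<And>i. i < m \<Longrightarrow> f' i = f i" "\<And>i. i < m \<Longrightarrow> v' i = v i"
      "\<And>i k. i < n \<Longrightarrow> k \<ge> N \<Longrightarrow> f' i k = 0" "\<And>i k. i < n \<Longrightarrow> k \<ge> N \<Longrightarrow> v' i k = 0"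
      "\<And>i j. i < n \<Longrightarrow> j < n \<Longrightarrow> dot (f' i) (v' j) = id_inf i j"
      by auto
    have fs: "finsup (f' i)" if "i < n" for i using 1(3)[OF that] unfolding finsup_def by blast
    obtain k where k: "k < N" "\<not> inspan n v' (id_inf k)"
      using indep_card_le[OF indep_unit[of N], of n v'] step by force
    \<comment> \<open>One step of the extension: \<open>y\<close> is a unit vector freed of its
      components along the \<open>v' i\<close>, and \<open>h\<close> is a coordinate
      \<open>q\<close> with \<open>y q \<noteq> 0\<close>, freed of the \<open>f' i\<close> and
      normalised. Both remain supported below \<open>N\<close>.\<close>
    define y where "y l = id_inf k l - (\<Sum>i<n. f' i k * v' i l)" for l
    obtain q where q: "y q \<noteq> 0"
      using k(2) unfolding inspan_def y_def by fastforce
    have y0: "y l = 0" if "l \<ge> N" for l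
      using that k(1) 1(4) by (simp add: y_def id_inf_def)
    then have qN: "q < N" using q not_less by blast
    have dy: "dot x y = dot x (id_inf k) - (\<Sum>i<n. f' i k * dot x (v' i))" for x
      unfolding y_def by (simp add: dot_diff_right dot_sum_right)
    have fy: "dot (f' i) y = 0" if "i < n" for i
    proof -
      have "(\<Sum>l<n. f' l k * dot (f' i) (v' l)) = (\<Sum>l<n. if l = i then f' l k else 0)"
        by (rule sum.cong) (use that 1(5) in \<open>auto simp: id_inf_def\<close>)
      then show ?thesis using that by (simp add: dy dot_unit_right fs)
    qed
    define h where "h l = (1 / y q) * (id_inf q l - (\<Sum>i<n. v' i q * f' i l))" for l
    have fsum: "finsup (\<lambda>l. \<Sum>i<n. v' i q * f' i l)"
      by (intro finsup_sum finsup_mult) (use fs in auto)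
    have dh: "dot h z = (1 / y q) * (z q - (\<Sum>i<n. v' i q * dot (f' i) z))" for z
    proof -
      have "dot h z = (1 / y q) * dot (\<lambda>l. id_inf q l - (\<Sum>i<n. v' i q * f' i l)) z"
        unfolding h_def by (rule dot_mult_left) (intro finsup_diff finsup_unit fsum)
      also have "dot (\<lambda>l. id_inf q l - (\<Sum>i<n. v' i q * f' i l)) z =
          z q - (\<Sum>i<n. v' i q * dot (f' i) z)"
        using dot_diff_left[OF finsup_unit fsum] dot_sum_left[of "{..<n}" f' "\<lambda>i. v' i q" z] fs by simp
      finally show ?thesis .
    qed
    have hv: "dot h (v' j) = 0" if "j < n" for j
    proof -
      have "(\<Sum>i<n. v' i q * dot (f' i) (v' j)) = (\<Sum>i<n. if i = j then v' i q else 0)"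
        by (rule sum.cong) (use that 1(5) in \<open>auto simp: id_inf_def\<close>)
      then show ?thesis using that by (simp add: dh)
    qed
    have hy: "dot h y = 1" using q fy by (simp add: dh)
    have h0: "h l = 0" if "l \<ge> N" for l
      using that qN 1(3) by (simp add: h_def id_inf_def)
    have mn: "i \<noteq> n" if "i < m" for i using that step by simp
    show ?case
    proof (rule exI[of _ "f'(n := h)"], rule exI[of _ "v'(n := y)"], intro conjI allI impI)
      fix i j assume "i < Suc n" "j < Suc n"
      then show "dot ((f'(n := h)) i) ((v'(n := y)) j) = id_inf i j"
        using 1(5) hv hy fy by (cases "i = n"; cases "j = n") (auto simp: id_inf_def)
    qed (use 1 h0 y0 mn in \<open>auto simp: less_Suc_eq\<close>)
  qed
  from this[OF assms(1) order_refl] show ?thesis .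
qed

text \<open>The given rows and columns extend to dual bases of the first \<open>N\<close>
  coordinates, that is, to an invertible matrix and its inverse. The determinant is brought to 1 by
  scaling one row and, inversely, the dual column at an index outside the block.\<close>

lemma conjugate_block:
  fixes P :: "'k::field inf_mat"
  assumes "SL_stable X" "P \<in> X" "\<And>i. i < n \<Longrightarrow> finsup (f i)" "\<And>i. i < n \<Longrightarrow> finsup (v i)"
    "\<And>i j. i < n \<Longrightarrow> j < n \<Longrightarrow> dot (f i) (v j) = id_inf i j"
  shows "\<exists>P'\<in>X. \<forall>i<n. \<forall>j<n. P' i j = dot (f i) (app P (v j))"
proof -
  obtain N1 where N1: "\<forall>i<n. \<forall>k\<ge>N1. f i k = 0" using finsup_common[of n f] assms(3) by blast
  obtain N2 where N2: "\<forall>i<n. \<forall>k\<ge>N2. v i k = 0" using finsup_common[of n v] assms(4) by blast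
  \<comment> \<open>\<open>Suc\<close> keeps the index \<open>N - 1\<close>, where the determinant
    is corrected, outside the \<open>n\<close>-block.\<close>
  define N where "N = Suc (max n (max N1 N2))"
  have "\<exists>f' v'. (\<forall>i<n. f' i = f i \<and> v' i = v i) \<and>
    (\<forall>i<N. \<forall>k\<ge>N. f' i k = 0 \<and> v' i k = 0) \<and> (\<forall>i<N. \<forall>j<N. dot (f' i) (v' j) = id_inf i j)"
    by (rule biorthogonal_extend) (use N1 N2 assms(5) in \<open>auto simp: N_def\<close>)
  then obtain f' v' where "\<forall>i<n. f' i = f i \<and> v' i = v i"
    "\<forall>i<N. \<forall>k\<ge>N. f' i k = 0 \<and> v' i k = 0" "\<forall>i<N. \<forall>j<N. dot (f' i) (v' j) = id_inf i j"
    by blast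
  then have 1: "\<And>i. i < n \<Longrightarrow> f' i = f i" "\<And>i. i < n \<Longrightarrow> v' i = v i"
      "\<And>i k. i < N \<Longrightarrow> k \<ge> N \<Longrightarrow> f' i k = 0" "\<And>i k. i < N \<Longrightarrow> k \<ge> N \<Longrightarrow> v' i k = 0"
      "\<And>i j. i < N \<Longrightarrow> j < N \<Longrightarrow> dot (f' i) (v' j) = id_inf i j"
    by auto
  define F where "F = mat N N (\<lambda>(i, k). f' i k)"
  define V where "V = mat N N (\<lambda>(k, j). v' j k)"
  have FV: "F \<in> carrier_mat N N" "V \<in> carrier_mat N N" by (simp_all add: F_def V_def)
  have dN: "dot (f' i) x = (\<Sum>k<N. f' i k * x k)" if "i < N" for i x
    by (rule dot_eq) (use 1(3) that in auto)
  have "F * V = 1\<^sub>m N"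
    by (rule eq_matI)
       (auto simp: F_def V_def scalar_prod_def atLeast0LessThan dN[symmetric] 1(5) id_inf_def)
  then have "det F * det V = 1" using det_mult[OF FV] by simp
  then have d: "det F \<noteq> 0" by auto
  define s where "s i = (if i = N - 1 then 1 / det F else 1)" for i
  have s: "s i \<noteq> 0" for i using d by (simp add: s_def)
  define A where "A = mat N N (\<lambda>(i, k). s i * f' i k)"
  define B where "B = mat N N (\<lambda>(k, j). v' j k / s j)"
  have AB: "A \<in> carrier_mat N N" "B \<in> carrier_mat N N" by (simp_all add: A_def B_def)
  have "A = multrow (N - 1) (1 / det F) F"
    by (rule eq_matI) (auto simp: A_def F_def s_def)
  then have detA: "det A = 1" using det_multrow[of "N - 1" N F] FV(1) d by (simp add: N_def)
  have "(\<Sum>k<N. s i * f' i k * (v' j k / s j)) = id_inf i j" if "i < N" "j < N" for i j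
  proof -
    have "(\<Sum>k<N. s i * f' i k * (v' j k / s j)) = s i / s j * dot (f' i) (v' j)"
      using that by (simp add: dN sum_distrib_left mult.assoc)
    then show ?thesis using s that by (simp add: 1(5) id_inf_def)
  qed
  then have AB1: "A * B = 1\<^sub>m N"
    by (intro eq_matI) (auto simp: A_def B_def scalar_prod_def atLeast0LessThan id_inf_def)
  have N: "1 \<le> N" by (simp add: N_def)
  let ?P = "conj_inf (diag_inf A) P"
  have "?P \<in> X" using assms(1,2) inv_SL_inf(1)[OF N AB AB1 detA] by (simp add: SL_stable_iff)
  moreover have "?P i j = dot (f i) (app P (v j))" if ij: "i < n" "j < n" for i j
  proof -
    have lt: "i < N - 1" "j < N - 1" using ij by (auto simp: N_def)
    have "diag_inf A i = f i"
    proof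
      fix k show "diag_inf A i k = f i k"
        unfolding diag_inf_eq[OF AB(1)]
        using lt 1(1)[OF ij(1)] 1(3)[of i k] by (auto simp: A_def s_def id_inf_def)
    qed
    moreover have "(\<lambda>k. diag_inf B k j) = v j"
    proof
      fix k show "diag_inf B k j = v j k"
        unfolding diag_inf_eq[OF AB(2)]
        using lt 1(2)[OF ij(2)] 1(4)[of j k] by (auto simp: B_def s_def id_inf_def)
    qed
    ultimately show ?thesis using conj_diag_inf[OF N AB AB1 detA, of P i j] by simp
  qed
  ultimately show ?thesis by blast
qed

section \<open>Stable closed sets\<close>

text \<open>A single matrix \<open>Q\<close> outside \<open>X\<close> has a block of some size
  \<open>n\<close> that no member of \<open>X\<close> has, and this \<open>n\<close> bounds the rank
  for all of \<open>X\<close> at once.\<close>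

lemma stable_closed_bounded_rank:
  fixes X :: "'k::field inf_mat set"
  assumes "closed_inf X" "SL_stable X" "X \<noteq> UNIV"
  shows "\<exists>k. X \<subseteq> {P. \<exists>c. rank_le k (shift P c)}"
proof -
  obtain Q where "Q \<notin> X" using assms(3) by blast
  then obtain n where n: "\<not> (\<exists>P\<in>X. \<forall>i<n. \<forall>j<n. P i j = Q i j)"
    using closed_inf_limit[OF assms(1), of Q] by blast
  have "\<exists>c. rank_le (2 * n) (shift P c)" if P: "P \<in> X" for P
  proof (rule scalar_plus_rank_le, rule notI)
    assume "\<exists>u. (\<forall>i<n. finsup (u i)) \<and> indep (2 * n) (pairs P u)"
    then obtain u where u: "\<And>i. i < n \<Longrightarrow> finsup (u i)" "indep (2 * n) (pairs P u)" by blast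
    obtain f where f: "\<And>i. i < n \<Longrightarrow> finsup (f i)"
      "\<And>i j. i < n \<Longrightarrow> j < n \<Longrightarrow> dot (f i) (u j) = id_inf i j"
      "\<And>i j. i < n \<Longrightarrow> j < n \<Longrightarrow> dot (f i) (app P (u j)) = Q i j"
      using pairs_functionals[OF u(2), of Q] by blast
    obtain P' where "P' \<in> X" "\<forall>i<n. \<forall>j<n. P' i j = dot (f i) (app P (u j))"
      using conjugate_block[OF assms(2) P f(1) u(1) f(2)] by blast
    with n f(3) show False by auto
  qed
  then show ?thesis by blast
qed

text \<open>Write \<open>Q - c\<close> as a sum of outer products of \<open>S l\<close> and
  \<open>T l\<close>. Choose \<open>v j\<close> pairing with \<open>b l\<close> to
  \<open>T l j\<close> and independent of the \<open>a l\<close>; then functionals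
  \<open>f i\<close> dual to the \<open>v j\<close> may still take the values \<open>S l i\<close>
  on the \<open>a l\<close>. The resulting block of the conjugate is that of
  \<open>Q\<close>.\<close>

lemma stable_closed_contains_lower_rank:
  fixes X :: "'k::field inf_mat set"
  assumes X: "closed_inf X" "SL_stable X" "P \<in> X"
    and a: "indep r a" and b: "\<And>l m. l < r \<Longrightarrow> m < r \<Longrightarrow> b l (\<sigma> m) = id_inf l m"
    and P: "\<And>i j. shift P c i j = (\<Sum>l<r. a l i * b l j)"
    and Q: "rank_le r (shift Q c)"
  shows "Q \<in> X"
proof (rule closed_inf_limit[OF X(1)])
  fix n
  obtain S T where ST: "\<And>i j. shift Q c i j = (\<Sum>l<r. S l i * T l j)"
    using Q unfolding rank_le_def by blast
  obtain v where v: "\<And>j. j < n \<Longrightarrow> finsup (v j)" "\<And>j l. j < n \<Longrightarrow> l < r \<Longrightarrow> dot (v j) (b l) = T l j"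
    "indep (r + n) (\<lambda>i. if i < r then a i else v (i - r))"
    using kernel_vectors[of r a b \<sigma> n T, OF a b] by blast
  obtain g where g: "\<And>i. i < r + n \<Longrightarrow> finsup (g i)"
    "\<And>i j. i < r + n \<Longrightarrow> j < r + n \<Longrightarrow> dot (g i) (if j < r then a j else v (j - r)) = id_inf i j"
    using dual_family[OF v(3)] by blast
  have ga: "dot (g i) (a l) = id_inf i l" if "i < r + n" "l < r" for i l
    using g(2)[of i l] that by simp
  have gv: "dot (g i) (v j) = id_inf i (r + j)" if "i < r + n" "j < n" for i j
    using g(2)[of i "r + j"] that by simp
  define f where "f = (\<lambda>i k. g (r + i) k + (\<Sum>l<r. S l i * g l k))"
  have f: "finsup (f i)" "dot (f i) x = dot (g (r + i)) x + (\<Sum>l<r. S l i * dot (g l) x)"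
    if "i < n" for i x
    using dot_affine_left[of "g (r + i)" "{..<r}" g "\<lambda>l. S l i"] g(1) that
    by (auto simp: f_def)
  have fv: "dot (f i) (v j) = id_inf i j" if "i < n" "j < n" for i j
    using that by (simp add: f(2) gv id_inf_def)
  have fa: "dot (f i) (a l) = S l i" if "i < n" "l < r" for i l
  proof -
    have "(\<Sum>m<r. S m i * dot (g m) (a l)) = (\<Sum>m<r. if m = l then S m i else 0)"
      by (rule sum.cong) (use that in \<open>auto simp: ga id_inf_def\<close>)
    then show ?thesis using that by (simp add: f(2) ga id_inf_def)
  qed
  obtain P' where P': "P' \<in> X" "\<And>i j. i < n \<Longrightarrow> j < n \<Longrightarrow> P' i j = dot (f i) (app P (v j))"
    using conjugate_block[OF X(2,3) f(1) v(1) fv] by blast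
  have "P' i j = Q i j" if "i < n" "j < n" for i j
  proof -
    have "app P (v j) = (\<lambda>i. c * v j i + 1 * (\<Sum>l<r. T l j * a l i))"
      using app_shift[of "v j" P c, OF v(1)[OF that(2)]] app_factorization[of "shift P c" a b r "v j", OF P] that(2)
      by (simp add: fun_eq_iff algebra_simps v(2))
    then have "P' i j = dot (f i) (\<lambda>i. c * v j i + 1 * (\<Sum>l<r. T l j * a l i))"
      using P'(2)[OF that] by simp
    also have "\<dots> = c * id_inf i j + (\<Sum>l<r. T l j * S l i)"
      unfolding dot_add_right dot_sum_right dot_mult_right using that by (simp add: fv fa)
    also have "\<dots> = c * id_inf i j + shift Q c i j" by (simp add: ST mult.commute)
    finally show ?thesis by (simp add: shift_def)
  qed
  then show "\<exists>P\<in>X. \<forall>i<n. \<forall>j<n. P i j = Q i j" using P'(1) by blast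
qed

section \<open>Stable closed sets described by sets of scalars\<close>

definition scalar_diag :: "'k::field \<Rightarrow> nat \<Rightarrow> 'k inf_mat" where
  "scalar_diag c r = (\<lambda>i j. (\<Sum>l<r. id_inf l i * id_inf l j) + c * id_inf i j)"

lemma shift_scalar_diag: "shift (scalar_diag c r) c i j = (\<Sum>l<r. id_inf l i * id_inf l j)"
  by (simp add: shift_def scalar_diag_def)

text \<open>Forwards, \<open>r\<close> is the exact rank of \<open>P - c\<close>, so that
  \<open>P\<close> pulls \<open>scalar_diag c r\<close> into \<open>X\<close>; backwards,
  \<open>scalar_diag c r\<close> pulls in \<open>P\<close>. The uniform bound \<open>k\<close>
  leaves finitely many sets of scalars, one for each \<open>r \<le> k\<close>.\<close>

lemma stable_closed_mem_iff:
  fixes X :: "'k::field inf_mat set"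
  assumes X: "closed_inf X" "SL_stable X" "X \<subseteq> {P. \<exists>c. rank_le k (shift P c)}"
  shows "P \<in> X \<longleftrightarrow> (\<exists>c. \<exists>r\<le>k. scalar_diag c r \<in> X \<and> rank_le r (shift P c))"
proof
  assume P: "P \<in> X"
  then obtain c where "rank_le k (shift P c)" using X(3) by blast
  then obtain r a b \<sigma> where r: "r \<le> k" and B: "indep r a"
    "\<And>l m. l < r \<Longrightarrow> m < r \<Longrightarrow> b l (\<sigma> m) = id_inf l m"
    "\<And>i j. shift P c i j = (\<Sum>l<r. a l i * b l j)"
    using rank_factorization[of k "shift P c"] by blast
  have rk: "rank_le r (shift (scalar_diag c r) c)"
    unfolding rank_le_def using shift_scalar_diag by blast
  have "scalar_diag c r \<in> X"
    by (rule stable_closed_contains_lower_rank[of X P r a b \<sigma> c]) (fact X(1) X(2) P B rk)+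
  moreover have "rank_le r (shift P c)" unfolding rank_le_def using B(3) by blast
  ultimately show "\<exists>c. \<exists>r\<le>k. scalar_diag c r \<in> X \<and> rank_le r (shift P c)" using r by blast
next
  assume "\<exists>c. \<exists>r\<le>k. scalar_diag c r \<in> X \<and> rank_le r (shift P c)"
  then obtain c r where "scalar_diag c r \<in> X" "rank_le r (shift P c)" by blast
  then show "P \<in> X"
    by (intro stable_closed_contains_lower_rank[of X "scalar_diag c r" r id_inf id_inf id c P])
       (use X(1,2) indep_unit shift_scalar_diag in simp_all)
qed

lemma scalar_diag_line:
  assumes "closed_inf X"
  shows "{c. scalar_diag c r \<in> X} = UNIV \<or> finite {c. scalar_diag c r \<in> X}"
  by (rule closed_inf_curve[OF assms]) (simp add: scalar_diag_def line_poly_affine)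

text \<open>Once some member is finite, one of least cardinality equals all later ones.\<close>

lemma decreasing_stabilizes:
  fixes A :: "nat \<Rightarrow> 'a set"
  assumes "\<And>i. A i = UNIV \<or> finite (A i)" "\<And>i. A (Suc i) \<subseteq> A i"
  shows "\<exists>N. \<forall>i\<ge>N. A i = A N"
proof (cases "\<forall>i. A i = UNIV")
  case False
  then obtain i0 where i0: "finite (A i0)" using assms(1) by blast
  have dec: "A j \<subseteq> A i" if "i \<le> j" for i j
    using lift_Suc_antimono_le[of A, OF assms(2) that] .
  define N where "N = arg_min (\<lambda>i. card (A i)) (\<lambda>i. i \<ge> i0)"
  have N: "N \<ge> i0" "\<And>i. i \<ge> i0 \<Longrightarrow> card (A N) \<le> card (A i)"
    using arg_min_nat_lemma[of "\<lambda>i. i \<ge> i0" i0 "\<lambda>i. card (A i)"] by (auto simp: N_def)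
  have "A i = A N" if "i \<ge> N" for i
  proof (rule card_seteq)
    show "finite (A N)" using i0 dec[OF N(1)] finite_subset by blast
    show "A i \<subseteq> A N" by (rule dec[OF that])
    show "card (A N) \<le> card (A i)" using N that by simp
  qed
  then show ?thesis by blast
qed simp

text \<open>The bound \<open>k\<close> of one proper member holds for all later ones, so it is
  enough that the sets of scalars for the finitely many \<open>r \<le> k\<close> become
  constant.\<close>

lemma stable_closed_noetherian:
  fixes X :: "nat \<Rightarrow> 'k::field inf_mat set"
  assumes X: "\<And>i. closed_inf (X i)" "\<And>i. SL_stable (X i)" and dec: "\<And>i. X (Suc i) \<subseteq> X i"
  shows "\<exists>N. \<forall>i\<ge>N. X i = X N"
proof (cases "\<forall>i. X i = UNIV")
  case False
  then obtain i0 where i0: "X i0 \<noteq> UNIV" by blast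
  obtain k where k: "X i0 \<subseteq> {P. \<exists>c. rank_le k (shift P c)}"
    using stable_closed_bounded_rank[OF X i0] by blast
  have sub: "X j \<subseteq> X i" if "i \<le> j" for i j
    using lift_Suc_antimono_le[of X, OF dec that] .
  define A where "A r i = {c. scalar_diag c r \<in> X (i0 + i)}" for r i
  have "\<exists>N. \<forall>i\<ge>N. A r i = A r N" for r
  proof (rule decreasing_stabilizes)
    show "A r i = UNIV \<or> finite (A r i)" for i
      unfolding A_def by (rule scalar_diag_line[OF X(1)])
    show "A r (Suc i) \<subseteq> A r i" for i
      using dec[of "i0 + i"] by (auto simp: A_def)
  qed
  then obtain M where M: "\<And>r i. i \<ge> M r \<Longrightarrow> A r i = A r (M r)" by metis
  define N where "N = Max (M ` {..k})"
  have A: "A r i = A r N" if "r \<le> k" "i \<ge> N" for r i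
  proof -
    have "M r \<le> N" unfolding N_def using that(1) by (intro Max_ge) auto
    then show ?thesis using M[of r i] M[of r N] that(2) by simp
  qed
  have mem: "P \<in> X (i0 + i) \<longleftrightarrow> (\<exists>c. \<exists>r\<le>k. c \<in> A r i \<and> rank_le r (shift P c))" for P i
  proof -
    have "X (i0 + i) \<subseteq> {P. \<exists>c. rank_le k (shift P c)}" using sub[of i0 "i0 + i"] k by auto
    then show ?thesis unfolding A_def mem_Collect_eq by (rule stable_closed_mem_iff[OF X])
  qed
  have "X (i0 + i) = X (i0 + N)" if "i \<ge> N" for i
    using A[OF _ that] by (auto simp: mem set_eq_iff)
  then have "X i = X (i0 + N)" if "i \<ge> i0 + N" for i
    using that le_Suc_ex by (metis add.assoc le_add1)
  then show ?thesis by blast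
qed simp

lemma SL_stable_UNIV: "SL_stable UNIV"
  by (simp add: SL_stable_def)

lemma SL_stable_rank: "SL_stable {P. rank_le k (shift P c)}"
  by (simp add: SL_stable_iff rank_le_conj)

lemma SL_stable_rank_tuple: "SL_stable {P. \<exists>c. rank_le k (shift P c)}"
  unfolding SL_stable_iff using rank_le_conj by blast

lemma stable_closed_decomposition:
  fixes X :: "'k::field inf_mat set"
  assumes X: "closed_inf X" "SL_stable X"
  shows "\<exists>F. finite F \<and> X = \<Union>F \<and> F \<subseteq> {UNIV} \<union> {{P. \<exists>c. rank_le k (shift P c)} | k. True}
    \<union> {{P. rank_le k (shift P c)} | c k. True}"
proof (cases "X = UNIV")
  case True
  then show ?thesis by (intro exI[of _ "{UNIV}"]) auto
next
  case False
  then obtain k where k: "X \<subseteq> {P. \<exists>c. rank_le k (shift P c)}"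
    using stable_closed_bounded_rank[OF X] by blast
  define A where "A r = {c. scalar_diag c r \<in> X}" for r
  define Z where "Z r = {P :: 'k inf_mat. \<exists>c. rank_le r (shift P c)}" for r
  define R where "R r c = {P :: 'k inf_mat. rank_le r (shift P c)}" for r c
  \<comment> \<open>If every scalar occurs for \<open>r\<close>, the pieces of rank at most
    \<open>r\<close> merge into one with free scalar; otherwise finitely many scalars occur, each
    with a piece of its own.\<close>
  define F where "F = Z ` {r. r \<le> k \<and> A r = UNIV} \<union> (\<Union>r\<in>{r. r \<le> k \<and> A r \<noteq> UNIV}. R r ` A r)"
  have "finite (A r)" if "A r \<noteq> UNIV" for r
    using scalar_diag_line[OF X(1), of r] that unfolding A_def by blast
  then have "finite F" unfolding F_def by auto
  moreover have "X = \<Union>F"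
  proof (intro subset_antisym subsetI)
    fix P assume "P \<in> X"
    then obtain c r where cr: "r \<le> k" "c \<in> A r" "rank_le r (shift P c)"
      using stable_closed_mem_iff[OF X k, of P] by (auto simp: A_def)
    show "P \<in> \<Union>F"
    proof (cases "A r = UNIV")
      case True
      then have "Z r \<in> F" "P \<in> Z r" using cr by (auto simp: F_def Z_def)
      then show ?thesis by blast
    next
      case False
      then have "R r c \<in> F" "P \<in> R r c" using cr by (auto simp: F_def R_def)
      then show ?thesis by blast
    qed
  next
    fix P assume "P \<in> \<Union>F"
    then obtain r c where "r \<le> k" "c \<in> A r" "rank_le r (shift P c)"
      by (auto simp: F_def Z_def R_def)
    then show "P \<in> X" using stable_closed_mem_iff[OF X k, of P] by (auto simp: A_def)
  qed
  moreover have "F \<subseteq> {UNIV} \<union> {{P. \<exists>c. rank_le k (shift P c)} | k. True}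
    \<union> {{P. rank_le k (shift P c)} | c k. True}"
    unfolding F_def Z_def R_def by blast
  ultimately show ?thesis by blast
qed

theorem theorem5:
  assumes "infinite (UNIV :: 'k::field set)"
  shows
    "(\<forall>X :: nat \<Rightarrow> 'k inf_mat set.
        (\<forall>i. closed_inf (X i) \<and> SL_stable (X i)) \<and> (\<forall>i. X (Suc i) \<subseteq> X i) \<longrightarrow>
        (\<exists>N. \<forall>i\<ge>N. X i = X N)) \<and>
     (\<forall>X :: 'k inf_mat set. closed_inf X \<and> SL_stable X \<longrightarrow>
        (\<exists>F. finite F \<and> (\<forall>Y\<in>F. irreducible_inf Y \<and> closed_inf Y \<and> SL_stable Y) \<and> X = \<Union>F)) \<and>
     {X :: 'k inf_mat set. irreducible_inf X \<and> closed_inf X \<and> SL_stable X} =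
       {UNIV}
       \<union> {{P. rk_tuple_inf [P, id_inf] \<le> enat k} | k. True}
       \<union> {{P. rk_inf (\<lambda>i j. P i j - c * id_inf i j) \<le> enat k} | c k. True}"
proof -
  let ?C = "{UNIV} \<union> {{P :: 'k inf_mat. \<exists>c. rank_le k (shift P c)} | k. True}
    \<union> {{P :: 'k inf_mat. rank_le k (shift P c)} | c k. True}"
  have C: "irreducible_inf Y \<and> closed_inf Y \<and> SL_stable Y" if "Y \<in> ?C" for Y
    using that irreducible_inf_UNIV[OF assms] irreducible_inf_rank[OF assms]
      irreducible_inf_rank_tuple[OF assms] closed_inf_UNIV closed_inf_rank closed_inf_rank_tuple
      SL_stable_UNIV SL_stable_rank SL_stable_rank_tuple
    by auto
  have irr: "{X :: 'k inf_mat set. irreducible_inf X \<and> closed_inf X \<and> SL_stable X} = ?C"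
  proof (intro equalityI subsetI)
    fix X :: "'k inf_mat set"
    assume X: "X \<in> {X. irreducible_inf X \<and> closed_inf X \<and> SL_stable X}"
    then obtain F where F: "finite F" "X = \<Union>F" "F \<subseteq> ?C"
      using stable_closed_decomposition[of X] by blast
    \<comment> \<open>An irreducible set is itself one of the pieces of any finite closed
      decomposition, so the classification follows from the decomposition.\<close>
    have "X \<in> F"
    proof (rule irreducible_inf_Union[OF F(1) _ F(2)])
      show "irreducible_inf X" using X by simp
      show "closed_inf Y" if "Y \<in> F" for Y using C[of Y] F(3) that by blast
    qed
    then show "X \<in> ?C" using F(3) by blast
  qed (use C in blast)
  have C': "?C = {UNIV} \<union> {{P. rk_tuple_inf [P, id_inf] \<le> enat k} | k. True}
       \<union> {{P. rk_inf (\<lambda>i j. P i j - c * id_inf i j) \<le> enat k} | c k. True}"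
    by (simp only: rk_tuple_le_iff rk_inf_le_iff shift_def)
  have dec: "\<exists>F. finite F \<and> (\<forall>Y\<in>F. irreducible_inf Y \<and> closed_inf Y \<and> SL_stable Y) \<and> X = \<Union>F"
    if X: "closed_inf X" "SL_stable X" for X :: "'k inf_mat set"
  proof -
    obtain F where "finite F" "X = \<Union>F" "F \<subseteq> ?C" using stable_closed_decomposition[OF X] by blast
    then show ?thesis using C by (intro exI[of _ F]) blast
  qed
  have noeth: "\<exists>N. \<forall>i\<ge>N. X i = X N"
    if "(\<forall>i. closed_inf (X i) \<and> SL_stable (X i)) \<and> (\<forall>i. X (Suc i) \<subseteq> X i)"
    for X :: "nat \<Rightarrow> 'k inf_mat set"
    by (rule stable_closed_noetherian) (use that in blast)+
  show ?thesis
    by (intro conjI allI impI, erule noeth, erule conjE, erule (1) dec, rule irr[unfolded C'])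
qed

end
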